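(* Let $n\ge 3$ and let $T$ be a star-like tree: a tree with a central vertex $c$ of degree $n$ such that $T$ is the union of $n$ paths (branches) meeting only at $c$, each branch starting at $c$ and having length at least $2$. Let $V$ be the vertex set of $T$, let $P=\{(0,\infty),(1,4)\}$, and let $$\mathbf{data}_P=\{z\in\mathbb{R}^V:\mathrm{PH}_0(z)=P\}.$$ Then $\mathbf{data}_P$ is homotopy equivalent to a bouquet (wedge) of $n^2-3n+1$ circles.
   Context: A vector $z\in\mathbb{R}^V$ is viewed as a function on vertices, extended to edges by taking the maximum over the two endpoints. For $r\in\mathbb{R}$, $T_r(z)$ is the subcomplex consisting of vertices $v$ with $z_v\le r$ and edges $[v,w]$ with $\max\{z_v,z_w\}\le r$. $\mathrm{PH}_0(z)$ is the degree-$0$ persistence diagram (multiset of (birth, death) pairs, death possibly $\infty$) of the sublevel-set filtration $r\mapsto T_r(z)$. $\mathbf{data}_P$ has the subspace topology of $\mathbb{R}^V$. *)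

theory Defs
  imports "HOL-Analysis.Analysis"
begin

definition star_like_tree :: "('v::finite) set set \<Rightarrow> nat \<Rightarrow> bool" where
  "star_like_tree E n \<longleftrightarrow>
     (\<exists>c ps. length ps = n \<and>
        (\<forall>p\<in>set ps. distinct p \<and> length p \<ge> 3 \<and> hd p = c) \<and>
        (\<forall>i<n. \<forall>j<n. i \<noteq> j \<longrightarrow> set (ps!i) \<inter> set (ps!j) = {c}) \<and>
        (\<Union>p\<in>set ps. set p) = UNIV \<and>
        E = (\<Union>p\<in>set ps. {{p!k, p!(k+1)} | k. k + 1 < length p}))"

text \<open>Number of connected components of the subgraph induced on S (vertices in S,
  edges with both endpoints in S) that contain a vertex of A.  For A = T_r, S = T_s
  (r \<le> s) this is the rank of H_0(T_r) \<rightarrow> H_0(T_s).\<close>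
definition comp_count :: "'v set set \<Rightarrow> 'v set \<Rightarrow> 'v set \<Rightarrow> nat" where
  "comp_count E A S =
     card ((\<lambda>v. {w \<in> S. (\<lambda>a b. a \<in> S \<and> b \<in> S \<and> {a, b} \<in> E)\<^sup>*\<^sup>* v w}) ` A)"

text \<open>Vertex set of the sublevel complex T_r(z) (edges of T_r are exactly those with both
  endpoints in it), and of T_{r-\<epsilon>} for \<epsilon> small (= strict sublevel set).\<close>
definition sub_le :: "real^'v \<Rightarrow> real \<Rightarrow> 'v set" where
  "sub_le z r = {v. z $ v \<le> r}"

definition sub_lt :: "real^'v \<Rightarrow> real \<Rightarrow> 'v set" where
  "sub_lt z r = {v. z $ v < r}"

text \<open>Degree-0 persistence diagram of the sublevel-set filtration, as a multiplicity
  function on (birth, death) pairs, death in ereal (\<infinity> = never dies), computed from the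
  rank function by the standard inclusion-exclusion formula (bars [b,d), b < d).\<close>
definition ph0 :: "'v set set \<Rightarrow> real^'v \<Rightarrow> real \<times> ereal \<Rightarrow> int" where
  "ph0 E z p = (case p of
     (b, PInfty) \<Rightarrow> int (comp_count E (sub_le z b) UNIV) - int (comp_count E (sub_lt z b) UNIV)
   | (b, ereal d) \<Rightarrow> (if b < d then
        int (comp_count E (sub_le z b) (sub_lt z d)) - int (comp_count E (sub_lt z b) (sub_lt z d))
      - int (comp_count E (sub_le z b) (sub_le z d)) + int (comp_count E (sub_lt z b) (sub_le z d))
      else 0)
   | (b, MInfty) \<Rightarrow> 0)"

definition PH0_eq :: "'v set set \<Rightarrow> real^'v \<Rightarrow> (real \<times> ereal) multiset \<Rightarrow> bool" where
  "PH0_eq E z P \<longleftrightarrow> (\<forall>p. ph0 E z p = int (count P p))"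

definition data :: "'v set set \<Rightarrow> (real \<times> ereal) multiset \<Rightarrow> (real^'v) set" where
  "data E P = {z. PH0_eq E z P}"

text \<open>Bouquet of k circles: the circles |x - j| = j, j = 1..k, in the complex plane,
  pairwise meeting only at 0.\<close>
definition bouquet :: "nat \<Rightarrow> complex set" where
  "bouquet k = (\<Union>j\<in>{1..k}. sphere (of_nat j) (of_nat j))"

end

theory Submission
  imports Defs
begin

text \<open>
  A vector \<open>z\<close> has the prescribed diagram iff it has a well at some vertex \<open>a\<close> of value \<open>0\<close>, a well at some
  \<open>b\<close> of value \<open>1\<close>, a peak \<open>p\<close> of value \<open>4\<close> on the path between them, and is otherwise monotone towards one
  of the wells. For fixed \<open>(a, p, b)\<close> this is a closed convex cell, and all cells with the same peak and the
  wells on prescribed sides of it share a point, so that their union is an absolute retract. Sliding the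
  peak along a branch glues these unions along absolute retracts. One obtains sets \<open>W\<^sub>i\<close> (peak on branch
  \<open>i\<close>, the deep well beyond it) and \<open>U\<^sub>j\<close> (the shallow well beyond the peak on branch \<open>j\<close>, or the peak at the
  centre and the shallow well on branch \<open>j\<close>). They cover the space; the \<open>U\<^sub>j\<close> are pairwise disjoint, the
  \<open>W\<^sub>i\<close> are pairwise disjoint, and \<open>U\<^sub>j \<inter> W\<^sub>i\<close> is an absolute retract for \<open>i \<noteq> j\<close> and empty for \<open>i = j\<close>.
  The nerve is thus the complete bipartite graph on \<open>n + n\<close> vertices minus a perfect matching, whose cycle
  rank is \<open>n(n - 1) - 2n + 1 = n\<^sup>2 - 3n + 1\<close>. Since maps into absolute retracts extend from closed subsets,
  spaces with equivalent covers of this kind are homotopy equivalent; this is applied twice, via a double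
  mapping cylinder, to reach the bouquet.
\<close>

section \<open>Covers by absolute retracts\<close>

text \<open>A vector does not determine its wells and peak: plateaus at 0, 1 and 4 allow several
  triples, so cells overlap and the real work is to control the overlaps. Both well values are
  strictly below 4, so a well of one triple is never a peak of another; and 0 < 1 keeps the deep and
  the shallow well from changing places. Comparing two spaces by covers needs a common nerve, but
  the nerve of the pieces is a graph with long cycles, unlike the loops of a bouquet. Regrouping the
  pieces along a spanning tree fails as well: their union already contains every overlap. Thickening
  each overlap to a cylinder allows those over the edges outside the tree to be set apart, so one
  space carries both kinds of cover. Branch length at least 2 puts a vertex beyond a peak next to
  the centre, so no piece and no prescribed overlap is empty; \<open>n \<ge> 3\<close> is what makes
  the nerve connected.\<close>

lemma AR_Union_convex_common_point:
  fixes C :: "'i \<Rightarrow> 'a::euclidean_space set"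
  assumes "finite I" "I \<noteq> {}" "\<And>i. i \<in> I \<Longrightarrow> closed (C i)" "\<And>i. i \<in> I \<Longrightarrow> convex (C i)"
    and "\<And>i. i \<in> I \<Longrightarrow> x \<in> C i"
  shows "AR (\<Union>i\<in>I. C i)"
  using assms
proof (induction I arbitrary: C rule: finite_ne_induct)
  case (singleton i)
  then show ?case by (auto intro: convex_imp_AR)
next
  case (insert k I)
  have 1: "AR (\<Union>i\<in>I. C i)" using insert by auto
  \<comment> \<open>The sets \<open>C i \<inter> C k\<close> are again convex and contain
    \<open>x\<close>; to apply the induction hypothesis to them, \<open>C\<close> has to be
    arbitrary.\<close>
  have 2: "AR (\<Union>i\<in>I. C i \<inter> C k)"
    by (rule insert.IH) (use insert.prems in \<open>auto intro: convex_Int\<close>)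
  have 3: "AR (C k)" by (rule convex_imp_AR) (use insert.prems in auto)
  have "AR ((\<Union>i\<in>I. C i) \<union> C k)"
  proof (rule AR_closed_Un)
    show "closed (\<Union>i\<in>I. C i)" using insert by (auto intro: closed_UN)
    show "AR ((\<Union>i\<in>I. C i) \<inter> C k)" using 2 by (simp only: Int_UN_distrib2 UN_simps)
  qed (use 1 3 insert.prems in auto)
  then show ?case by (simp add: Un_commute)
qed

text \<open>Star-shaped gluing: since different \<open>Z i\<close> meet only inside the hub
  \<open>Y\<close>, each new one meets what is already built in
  \<open>Y \<inter> Z i\<close>.\<close>

lemma AR_Un_family:
  fixes Z :: "'i \<Rightarrow> 'a::euclidean_space set"
  assumes "finite I" "closed Y" "AR Y" "\<And>i. i \<in> I \<Longrightarrow> closed (Z i)" "\<And>i. i \<in> I \<Longrightarrow> AR (Z i)"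
    and "\<And>i. i \<in> I \<Longrightarrow> AR (Y \<inter> Z i)"
    and "\<And>i j. i \<in> I \<Longrightarrow> j \<in> I \<Longrightarrow> i \<noteq> j \<Longrightarrow> Z i \<inter> Z j \<subseteq> Y"
  shows "AR (Y \<union> (\<Union>i\<in>I. Z i))"
  using assms
proof (induction I rule: finite_induct)
  case (insert k I)
  have "AR ((Y \<union> (\<Union>i\<in>I. Z i)) \<union> Z k)"
  proof (rule AR_closed_Un)
    have "(Y \<union> (\<Union>i\<in>I. Z i)) \<inter> Z k = Y \<inter> Z k"
      using insert.prems(6)[of _ k] insert.hyps by fast
    then show "AR ((Y \<union> (\<Union>i\<in>I. Z i)) \<inter> Z k)" using insert.prems by simp
  qed (use insert in \<open>auto intro!: closed_UN closed_Un\<close>)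
  then show ?case by (simp add: Un_ac)
qed auto

text \<open>The last hypothesis is a running intersection property: what a new member shares with an
  earlier one is already in its immediate predecessor, so only consecutive overlaps count.\<close>

lemma AR_Un_chain:
  fixes V :: "nat \<Rightarrow> 'a::euclidean_space set"
  assumes "\<And>m. m \<le> N \<Longrightarrow> closed (V m)" "\<And>m. m \<le> N \<Longrightarrow> AR (V m)"
    and "\<And>m. m < N \<Longrightarrow> AR (V m \<inter> V (Suc m))"
    and "\<And>l m. l \<le> m \<Longrightarrow> m < N \<Longrightarrow> V l \<inter> V (Suc m) \<subseteq> V m"
  shows "AR (\<Union>m\<le>N. V m)"
  using assms
proof (induction N)
  case (Suc N)
  have "AR ((\<Union>m\<le>N. V m) \<union> V (Suc N))"
  proof (rule AR_closed_Un)
    have "(\<Union>m\<le>N. V m) \<inter> V (Suc N) = V N \<inter> V (Suc N)"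
      using Suc.prems(4)[of _ N] by fast
    then show "AR ((\<Union>m\<le>N. V m) \<inter> V (Suc N))" using Suc.prems by simp
  qed (use Suc in \<open>auto intro!: closed_UN\<close>)
  then show ?case by (simp add: atMost_Suc Un_commute)
qed auto

section \<open>Maps and homotopies carried by a cover\<close>

text \<open>An absolute retract is an absolute extensor for closed subsets. \<open>AR T\<close> is
  demanded only for nonempty \<open>Y\<close>, because an empty overlap may have an empty
  target.\<close>

lemma AR_extend_step:
  fixes h :: "'a::euclidean_space \<Rightarrow> 'b::euclidean_space"
  assumes "closed D" "closed Y" "continuous_on D h" "h ` (D \<inter> Y) \<subseteq> T" "Y \<noteq> {} \<Longrightarrow> AR T"
  obtains g where "continuous_on (D \<union> Y) g" "\<And>x. x \<in> D \<Longrightarrow> g x = h x" "g ` Y \<subseteq> T"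
proof (cases "Y = {}")
  case True
  then show ?thesis using assms that[of h] by auto
next
  case False
  have "continuous_on (D \<inter> Y) h" using assms(3) continuous_on_subset by blast
  moreover have "closedin (top_of_set Y) (D \<inter> Y)"
    using closedin_closed_Int[OF assms(1), of Y] by (simp only: Int_commute)
  ultimately obtain k where k: "continuous_on Y k" "k ` Y \<subseteq> T" "\<And>x. x \<in> D \<inter> Y \<Longrightarrow> k x = h x"
    using AR_imp_absolute_extensor[of T "D \<inter> Y" h Y] assms(4,5) False by metis
  have "continuous_on (D \<union> Y) (\<lambda>x. if x \<in> D then h x else k x)"
    by (rule continuous_on_If) (use assms k in auto)
  then show ?thesis
    using that[of "\<lambda>x. if x \<in> D then h x else k x"] k(2,3) assms(4) by (auto simp: image_subset_iff)
qed

text \<open>Triple intersections are required to be empty, so the nerve is a graph and carried maps can be built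
  first on the pairwise intersections and then on the members of the cover.\<close>

definition AR_cover :: "'i set \<Rightarrow> ('i \<Rightarrow> 'a::euclidean_space set) \<Rightarrow> bool" where
  "AR_cover I X \<longleftrightarrow> finite I \<and> (\<forall>i\<in>I. closed (X i) \<and> AR (X i))
     \<and> (\<forall>i\<in>I. \<forall>j\<in>I. i \<noteq> j \<longrightarrow> X i \<inter> X j = {} \<or> AR (X i \<inter> X j))
     \<and> (\<forall>i\<in>I. \<forall>j\<in>I. \<forall>k\<in>I. i \<noteq> j \<longrightarrow> j \<noteq> k \<longrightarrow> i \<noteq> k \<longrightarrow> X i \<inter> X j \<inter> X k = {})"

text \<open>The members \<open>X i\<close> need not be absolute retracts, so the lemma also applies
  to cylinders. \<open>D\<close> carries prescribed values: it is empty when a map is constructed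
  and consists of the two ends when a homotopy is.\<close>

lemma AR_cover_carrier_extension:
  fixes X :: "'i \<Rightarrow> 'a::euclidean_space set" and Z :: "'i \<Rightarrow> 'b::euclidean_space set"
  assumes fin: "finite I" and clo: "\<And>i. i \<in> I \<Longrightarrow> closed (X i)"
    and triple: "\<And>i j k. \<lbrakk>i \<in> I; j \<in> I; k \<in> I; i \<noteq> j; j \<noteq> k; i \<noteq> k\<rbrakk> \<Longrightarrow> X i \<inter> X j \<inter> X k = {}"
    and Z: "AR_cover I Z"
    and nerve: "\<And>i j. \<lbrakk>i \<in> I; j \<in> I; i \<noteq> j; X i \<inter> X j \<noteq> {}\<rbrakk> \<Longrightarrow> Z i \<inter> Z j \<noteq> {}"
    and D: "closed D" "continuous_on D h" "D \<subseteq> (\<Union>i\<in>I. X i)"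
    and carr: "\<And>i. i \<in> I \<Longrightarrow> h ` (D \<inter> X i) \<subseteq> Z i"
  obtains f where "continuous_on (\<Union>i\<in>I. X i) f" "\<And>i. i \<in> I \<Longrightarrow> f ` X i \<subseteq> Z i"
    "\<And>x. x \<in> D \<Longrightarrow> f x = h x"
proof -
  define P where "P = {(i,j). i \<in> I \<and> j \<in> I \<and> i \<noteq> j}"
  define O2 where "O2 = (\<lambda>(i,j). X i \<inter> X j)"
  have finP: "finite P" by (rule finite_subset[of _ "I \<times> I"]) (auto simp: P_def fin)
  have cloO: "closed (O2 q)" if "q \<in> P" for q using that clo by (auto simp: P_def O2_def)
  have "\<exists>f. continuous_on (D \<union> (\<Union>q\<in>Q. O2 q)) f \<and> (\<forall>x\<in>D. f x = h x)
      \<and> (\<forall>i\<in>I. f ` ((D \<union> (\<Union>q\<in>Q. O2 q)) \<inter> X i) \<subseteq> Z i)" if "Q \<subseteq> P" for Q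
    using finite_subset[OF that finP] that
  proof (induction Q rule: finite_induct)
    case empty
    show ?case using D carr by (intro exI[of _ h]) simp
  next
    case (insert q Q)
    then obtain f where f: "continuous_on (D \<union> (\<Union>q\<in>Q. O2 q)) f" "\<forall>x\<in>D. f x = h x"
      "\<forall>i\<in>I. f ` ((D \<union> (\<Union>q\<in>Q. O2 q)) \<inter> X i) \<subseteq> Z i" by auto
    obtain i j where q: "q = (i,j)" "i \<in> I" "j \<in> I" "i \<noteq> j" using insert.prems by (auto simp: P_def)
    let ?D = "D \<union> (\<Union>q\<in>Q. O2 q)"
    obtain g where g: "continuous_on (?D \<union> O2 q) g" "\<And>x. x \<in> ?D \<Longrightarrow> g x = f x" "g ` O2 q \<subseteq> Z i \<inter> Z j"
    proof (rule AR_extend_step[of ?D "O2 q" f "Z i \<inter> Z j"])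
      show "closed ?D" using insert cloO D by (auto intro!: closed_Un closed_UN)
      show "closed (O2 q)" using insert cloO by auto
      show "f ` (?D \<inter> O2 q) \<subseteq> Z i \<inter> Z j" using f(3) q unfolding O2_def by blast
      show "AR (Z i \<inter> Z j)" if "O2 q \<noteq> {}"
        using nerve[of i j] Z q that unfolding AR_cover_def O2_def by auto
    qed (use f in auto)
    have "g ` ((?D \<union> O2 q) \<inter> X k) \<subseteq> Z k" if "k \<in> I" for k
    proof clarify
      fix x assume x: "x \<in> ?D \<union> O2 q" "x \<in> X k"
      show "g x \<in> Z k"
      proof (cases "x \<in> ?D")
        case True
        then show ?thesis using g(2) f(3) x that by fastforce
      next
        case False
        then have "x \<in> X i" "x \<in> X j" using x q by (auto simp: O2_def)
        \<comment> \<open>A new point of an overlap lies in no third member, so the value in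
          \<open>Z i \<inter> Z j\<close> meets every carrier condition.\<close>
        then have "k = i \<or> k = j" using triple[of i j k] q that x by auto
        then show ?thesis using g(3) x False by auto
      qed
    qed
    moreover have "D \<union> (\<Union>q\<in>insert q Q. O2 q) = ?D \<union> O2 q" by auto
    ultimately show ?case using g f by (intro exI[of _ g]) auto
  qed
  from this[of P] obtain f0 where f0: "continuous_on (D \<union> (\<Union>q\<in>P. O2 q)) f0" "\<forall>x\<in>D. f0 x = h x"
      "\<forall>i\<in>I. f0 ` ((D \<union> (\<Union>q\<in>P. O2 q)) \<inter> X i) \<subseteq> Z i" by auto
  define D' where "D' = D \<union> (\<Union>q\<in>P. O2 q)"
  have D': "closed D'" using finP cloO D by (auto simp: D'_def intro!: closed_Un closed_UN)
  have "\<exists>f. continuous_on (D' \<union> (\<Union>i\<in>J. X i)) f \<and> (\<forall>x\<in>D. f x = h x)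
      \<and> (\<forall>i\<in>I. f ` ((D' \<union> (\<Union>i\<in>J. X i)) \<inter> X i) \<subseteq> Z i)" if "J \<subseteq> I" for J
    using finite_subset[OF that fin] that
  proof (induction J rule: finite_induct)
    case empty
    show ?case using f0 by (auto simp: D'_def)
  next
    case (insert k J)
    let ?D = "D' \<union> (\<Union>i\<in>J. X i)"
    obtain f where f: "continuous_on ?D f" "\<forall>x\<in>D. f x = h x" "\<forall>i\<in>I. f ` (?D \<inter> X i) \<subseteq> Z i"
      using insert by auto
    obtain g where g: "continuous_on (?D \<union> X k) g" "\<And>x. x \<in> ?D \<Longrightarrow> g x = f x" "g ` X k \<subseteq> Z k"
    proof (rule AR_extend_step[of ?D "X k" f "Z k"])
      show "closed ?D" using insert clo D' by (auto intro!: closed_Un closed_UN)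
    qed (use f insert clo Z in \<open>auto simp: AR_cover_def\<close>)
    have "g ` ((?D \<union> X k) \<inter> X i) \<subseteq> Z i" if "i \<in> I" for i
    proof clarify
      fix x assume x: "x \<in> ?D \<union> X k" "x \<in> X i"
      show "g x \<in> Z i"
      proof (cases "x \<in> ?D")
        case True
        then show ?thesis using g(2) f(3) x that by fastforce
      next
        case False
        \<comment> \<open>All overlaps are in the domain already; a new point of \<open>X k\<close>
          belongs to no other member.\<close>
        have "i = k"
        proof (rule ccontr)
          assume "i \<noteq> k"
          then have "(i,k) \<in> P" using that insert by (auto simp: P_def)
          moreover have "x \<in> O2 (i,k)" using x False by (auto simp: O2_def)
          ultimately show False using False by (auto simp: D'_def)
        qed
        then show ?thesis using g(3) x False by auto
      qed
    qed
    moreover have "D' \<union> (\<Union>i\<in>insert k J. X i) = ?D \<union> X k" by auto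
    moreover have "\<forall>x\<in>D. g x = h x" using g(2) f(2) by (auto simp: D'_def)
    ultimately show ?case using g(1) by (intro exI[of _ g]) auto
  qed
  from this[of I] obtain f where f: "continuous_on (D' \<union> (\<Union>i\<in>I. X i)) f" "\<forall>x\<in>D. f x = h x"
    "\<forall>i\<in>I. f ` ((D' \<union> (\<Union>i\<in>I. X i)) \<inter> X i) \<subseteq> Z i" by auto
  show ?thesis
  proof (rule that[of f])
    show "continuous_on (\<Union>i\<in>I. X i) f" using f(1) continuous_on_subset by blast
    show "f ` X i \<subseteq> Z i" if "i \<in> I" for i using f(3) that by fastforce
  qed (use f in auto)
qed

text \<open>A homotopy is a carried map on the cylinder. The sets \<open>{0..1} \<times> X i\<close>
  have the same nerve as the \<open>X i\<close>, and \<open>f\<close> and \<open>g\<close> prescribe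
  the values at the two ends.\<close>

lemma carried_maps_homotopic:
  fixes X :: "'i \<Rightarrow> 'a::euclidean_space set" and Z :: "'i \<Rightarrow> 'b::euclidean_space set"
  assumes X: "AR_cover I X" and Z: "AR_cover I Z"
    and nerve: "\<And>i j. \<lbrakk>i \<in> I; j \<in> I; i \<noteq> j; X i \<inter> X j \<noteq> {}\<rbrakk> \<Longrightarrow> Z i \<inter> Z j \<noteq> {}"
    and f: "continuous_on (\<Union>i\<in>I. X i) f" "\<And>i. i \<in> I \<Longrightarrow> f ` X i \<subseteq> Z i"
    and g: "continuous_on (\<Union>i\<in>I. X i) g" "\<And>i. i \<in> I \<Longrightarrow> g ` X i \<subseteq> Z i"
  shows "homotopic_with_canon (\<lambda>x. True) (\<Union>i\<in>I. X i) (\<Union>i\<in>I. Z i) f g"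
proof -
  let ?X = "\<Union>i\<in>I. X i"
  have fin: "finite I" and clo: "\<And>i. i \<in> I \<Longrightarrow> closed (X i)" using X by (auto simp: AR_cover_def)
  have cloX: "closed ?X" using fin clo by (auto intro: closed_UN)
  define h where "h = (\<lambda>y::real \<times> 'a. if y \<in> {0} \<times> ?X then f (snd y) else g (snd y))"
  have eq: "(\<Union>i\<in>I. {0..1::real} \<times> X i) = {0..1} \<times> ?X" by auto
  have 1: "continuous_on ({0} \<times> ?X \<union> {1} \<times> ?X) h" unfolding h_def
  proof (rule continuous_on_If)
    show "continuous_on ({0::real} \<times> ?X) (\<lambda>y. f (snd y))" "continuous_on ({1::real} \<times> ?X) (\<lambda>y. g (snd y))"
      by (intro continuous_on_compose2[OF f(1)] continuous_on_compose2[OF g(1)] continuous_intros; force)+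
  qed (use cloX in \<open>auto intro: closed_Times\<close>)
  obtain k where k: "continuous_on (\<Union>i\<in>I. {0..1::real} \<times> X i) k"
     "\<And>i. i \<in> I \<Longrightarrow> k ` ({0..1} \<times> X i) \<subseteq> Z i" "\<And>y. y \<in> {0} \<times> ?X \<union> {1} \<times> ?X \<Longrightarrow> k y = h y"
  proof (rule AR_cover_carrier_extension[of I "\<lambda>i. {0..1::real} \<times> X i" Z "{0} \<times> ?X \<union> {1} \<times> ?X" h])
    show "({0..1::real} \<times> X i) \<inter> ({0..1} \<times> X j) \<inter> ({0..1} \<times> X k) = {}"
      if "i \<in> I" "j \<in> I" "k \<in> I" "i \<noteq> j" "j \<noteq> k" "i \<noteq> k" for i j k
    proof -
      have "X i \<inter> X j \<inter> X k = {}" using X that unfolding AR_cover_def by blast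
      then show ?thesis by (simp add: Times_Int_Times)
    qed
    show "Z i \<inter> Z j \<noteq> {}" if "i \<in> I" "j \<in> I" "i \<noteq> j" "({0..1::real} \<times> X i) \<inter> ({0..1} \<times> X j) \<noteq> {}" for i j
      using that nerve[of i j] by (auto simp: Times_Int_Times)
    show "closed ({0::real} \<times> ?X \<union> {1} \<times> ?X)" using cloX by (auto intro!: closed_Un closed_Times)
    show "h ` (({0} \<times> ?X \<union> {1} \<times> ?X) \<inter> ({0..1} \<times> X i)) \<subseteq> Z i" if "i \<in> I" for i
      using f(2)[OF that] g(2)[OF that] by (auto simp: h_def)
    show "{0} \<times> ?X \<union> {1} \<times> ?X \<subseteq> (\<Union>i\<in>I. {0..1::real} \<times> X i)" by auto
  qed (use fin clo Z 1 in \<open>auto intro: closed_Times\<close>)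
  show ?thesis
  proof (subst homotopic_with, simp, intro exI conjI)
    show "continuous_map (prod_topology (top_of_set {0..1}) (top_of_set ?X)) (top_of_set (\<Union>i\<in>I. Z i)) k"
    proof -
      have "k ` ({0..1} \<times> ?X) \<subseteq> (\<Union>i\<in>I. Z i)" using k(2) by fastforce
      then show ?thesis using k(1) by (simp add: eq image_subset_iff_funcset)
    qed
    show "\<forall>x\<in>topspace (top_of_set ?X). k (0, x) = f x" using k(3) by (auto simp: h_def)
    show "\<forall>x\<in>topspace (top_of_set ?X). k (1, x) = g x" using k(3) by (auto simp: h_def)
  qed auto
qed

text \<open>Carried maps exist in both directions. Each composite is carried by the same cover as
  the identity and is therefore homotopic to it.\<close>

lemma AR_covers_homotopy_eqv:
  fixes X :: "'i \<Rightarrow> 'a::euclidean_space set" and Z :: "'i \<Rightarrow> 'b::euclidean_space set"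
  assumes X: "AR_cover I X" and Z: "AR_cover I Z"
    and nerve: "\<And>i j. \<lbrakk>i \<in> I; j \<in> I; i \<noteq> j\<rbrakk> \<Longrightarrow> X i \<inter> X j = {} \<longleftrightarrow> Z i \<inter> Z j = {}"
  shows "(\<Union>i\<in>I. X i) homotopy_eqv (\<Union>i\<in>I. Z i)"
proof -
  have ex: "\<exists>f. continuous_on (\<Union>i\<in>I. A i) f \<and> (\<forall>i\<in>I. f ` A i \<subseteq> B i)"
    if "AR_cover I A" "AR_cover I B" "\<And>i j. \<lbrakk>i \<in> I; j \<in> I; i \<noteq> j\<rbrakk> \<Longrightarrow> A i \<inter> A j = {} \<longleftrightarrow> B i \<inter> B j = {}"
    for A :: "'i \<Rightarrow> 'c::euclidean_space set" and B :: "'i \<Rightarrow> 'd::euclidean_space set"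
    using AR_cover_carrier_extension[of I A B "{}" "\<lambda>_. 0"] that
    unfolding AR_cover_def by (smt (verit) closed_empty continuous_on_empty empty_subsetI image_empty inf_bot_left)
  obtain f where f: "continuous_on (\<Union>i\<in>I. X i) f" "\<forall>i\<in>I. f ` X i \<subseteq> Z i" using ex[OF X Z nerve] by auto
  obtain g where g: "continuous_on (\<Union>i\<in>I. Z i) g" "\<forall>i\<in>I. g ` Z i \<subseteq> X i" using ex[OF Z X nerve[symmetric]] by auto
  have fi: "f ` (\<Union>i\<in>I. X i) \<subseteq> (\<Union>i\<in>I. Z i)" and gi: "g ` (\<Union>i\<in>I. Z i) \<subseteq> (\<Union>i\<in>I. X i)"
    using f(2) g(2) by (fastforce simp: image_subset_iff)+
  have "continuous_on (\<Union>i\<in>I. X i) (g \<circ> f)" "continuous_on (\<Union>i\<in>I. Z i) (f \<circ> g)"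
    by (rule continuous_on_compose; use f(1) g(1) fi gi continuous_on_subset in metis)+
  moreover have "(g \<circ> f) ` X i \<subseteq> X i" "(f \<circ> g) ` Z i \<subseteq> Z i" if "i \<in> I" for i
    using f(2) g(2) that by (auto simp: image_subset_iff)
  ultimately have "homotopic_with_canon (\<lambda>x. True) (\<Union>i\<in>I. X i) (\<Union>i\<in>I. X i) (g \<circ> f) id"
    "homotopic_with_canon (\<lambda>x. True) (\<Union>i\<in>I. Z i) (\<Union>i\<in>I. Z i) (f \<circ> g) id"
    by (intro carried_maps_homotopic[OF X X] carried_maps_homotopic[OF Z Z]; simp add: continuous_on_id')+
  then show ?thesis
    unfolding homotopy_equivalent_space_def
    using f(1) g(1) fi gi by (intro exI[of _ f] exI[of _ g]) (simp add: image_subset_iff_funcset)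
qed

lemma AR_imp_nonempty: "AR S \<Longrightarrow> S \<noteq> {}" for S :: "'a::euclidean_space set"
  by (simp add: AR_ANR)

section \<open>The two shapes of nerve\<close>

definition bipartite_AR_cover :: "nat \<Rightarrow> (nat \<Rightarrow> 'a::euclidean_space set) \<Rightarrow> (nat \<Rightarrow> 'a set) \<Rightarrow> bool" where
  "bipartite_AR_cover n U W \<longleftrightarrow>
     (\<forall>i<n. closed (U i) \<and> AR (U i) \<and> closed (W i) \<and> AR (W i) \<and> U i \<inter> W i = {}) \<and>
     (\<forall>i<n. \<forall>j<n. i \<noteq> j \<longrightarrow> U i \<inter> U j = {} \<and> W i \<inter> W j = {} \<and> AR (U j \<inter> W i))"

lemma bipartite_AR_covers_homotopy_eqv:
  fixes U W :: "nat \<Rightarrow> 'a::euclidean_space set" and U' W' :: "nat \<Rightarrow> 'b::euclidean_space set"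
  assumes "bipartite_AR_cover n U W" "bipartite_AR_cover n U' W'"
  shows "((\<Union>i<n. U i) \<union> (\<Union>i<n. W i)) homotopy_eqv ((\<Union>i<n. U' i) \<union> (\<Union>i<n. W' i))"
proof -
  have cov: "AR_cover (UNIV \<times> {..<n}) (\<lambda>(b,i). if b then U i else W i)"
    if "bipartite_AR_cover n U W" for U W :: "nat \<Rightarrow> 'c::euclidean_space set"
  proof -
    have 1: "AR (U j \<inter> W i)" "AR (W i \<inter> U j)" if "i < n" "j < n" "i \<noteq> j" for i j
      using \<open>bipartite_AR_cover n U W\<close> that unfolding bipartite_AR_cover_def by (auto simp: Int_commute)
    have 2: "U i \<inter> U j = {}" "W i \<inter> W j = {}" if "i < n" "j < n" "i \<noteq> j" for i j
      using \<open>bipartite_AR_cover n U W\<close> that unfolding bipartite_AR_cover_def by auto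
    have 3: "closed (U i) \<and> AR (U i) \<and> closed (W i) \<and> AR (W i) \<and> U i \<inter> W i = {}" if "i < n" for i
      using \<open>bipartite_AR_cover n U W\<close> that unfolding bipartite_AR_cover_def by auto
    have 4: "W i \<inter> U i = {}" if "i < n" for i using 3[OF that] by auto
    have tr: "X \<inter> Y \<inter> Z = {}" if "X \<inter> Y = {} \<or> Y \<inter> Z = {} \<or> X \<inter> Z = {}" for X Y Z :: "'c set"
      using that by auto
    have "(\<lambda>(b,i). if b then U i else W i) x \<inter> (\<lambda>(b,i). if b then U i else W i) y \<inter>
          (\<lambda>(b,i). if b then U i else W i) z = {}"
      if "x \<in> UNIV \<times> {..<n}" "y \<in> UNIV \<times> {..<n}" "z \<in> UNIV \<times> {..<n}" "x \<noteq> y" "y \<noteq> z" "x \<noteq> z" for x y z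
    proof -
      have "(\<lambda>(b,i). if b then U i else W i) x \<inter> (\<lambda>(b,i). if b then U i else W i) y = {}"
        if "x \<in> UNIV \<times> {..<n}" "y \<in> UNIV \<times> {..<n}" "x \<noteq> y" "fst x = fst y" for x y
        using that 2 by (cases x; cases y; cases "fst x") simp_all
      note same = this
      \<comment> \<open>Two of three members are on the same side of the bipartition and thus
        disjoint.\<close>
      have "fst x = fst y \<or> fst y = fst z \<or> fst x = fst z" by auto
      then show ?thesis
        using same[OF that(1,2,4)] same[OF that(2,3,5)] same[OF that(1,3,6)] by (intro tr) blast
    qed
    moreover have "(\<lambda>(b,i). if b then U i else W i) x \<inter> (\<lambda>(b,i). if b then U i else W i) y = {} \<or>
       AR ((\<lambda>(b,i). if b then U i else W i) x \<inter> (\<lambda>(b,i). if b then U i else W i) y)"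
      if "x \<in> UNIV \<times> {..<n}" "y \<in> UNIV \<times> {..<n}" "x \<noteq> y" for x y
      using that 1 2 3 4 by (cases x; cases y; cases "snd x = snd y"; auto)
    ultimately show ?thesis unfolding AR_cover_def using 3 by auto
  qed
  have eq: "(\<Union>x\<in>UNIV \<times> {..<n}. (\<lambda>(b,i). if b then U i else W i) x) = (\<Union>i<n. U i) \<union> (\<Union>i<n. W i)"
    for U W :: "nat \<Rightarrow> 'c set"
  proof (intro equalityI subsetI)
    fix v assume "v \<in> (\<Union>i<n. U i) \<union> (\<Union>i<n. W i)"
    then obtain i b where "i < n" "v \<in> (if b then U i else W i)" by (metis UN_E Un_iff lessThan_iff)
    then show "v \<in> (\<Union>x\<in>UNIV \<times> {..<n}. (\<lambda>(b,i). if b then U i else W i) x)"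
      by (intro UN_I[of "(b,i)"]) auto
  qed (auto split: if_splits)
  have nonempty: "U j \<inter> W i \<noteq> {}" "W i \<inter> U j \<noteq> {}" "U i \<inter> U j = {}" "W i \<inter> W j = {}"
    if "bipartite_AR_cover n U W" "i < n" "j < n" "i \<noteq> j" for i j and U W :: "nat \<Rightarrow> 'c::euclidean_space set"
  proof -
    have "AR (U j \<inter> W i)" "U i \<inter> U j = {}" "W i \<inter> W j = {}"
      using that unfolding bipartite_AR_cover_def by simp_all
    then show "U j \<inter> W i \<noteq> {}" "W i \<inter> U j \<noteq> {}" "U i \<inter> U j = {}" "W i \<inter> W j = {}"
      using AR_imp_nonempty[of "U j \<inter> W i"] by (simp_all add: Int_commute)
  qed
  have same: "U i \<inter> W i = {}" "W i \<inter> U i = {}"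
    if "bipartite_AR_cover n U W" "i < n" for i and U W :: "nat \<Rightarrow> 'c::euclidean_space set"
  proof -
    show "U i \<inter> W i = {}" using that unfolding bipartite_AR_cover_def by simp
    then show "W i \<inter> U i = {}" by (simp add: Int_commute)
  qed
  show ?thesis
    unfolding eq[symmetric]
  proof (rule AR_covers_homotopy_eqv)
    fix x y :: "bool \<times> nat"
    assume *: "x \<in> UNIV \<times> {..<n}" "y \<in> UNIV \<times> {..<n}" "x \<noteq> y"
    obtain b i where x: "x = (b,i)" "i < n" using * by auto
    obtain d j where y: "y = (d,j)" "j < n" using * by auto
    show "((case x of (b, i) \<Rightarrow> if b then U i else W i) \<inter> (case y of (b, i) \<Rightarrow> if b then U i else W i) = {}) =
       ((case x of (b, i) \<Rightarrow> if b then U' i else W' i) \<inter> (case y of (b, i) \<Rightarrow> if b then U' i else W' i) = {})"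
    proof (cases "i = j")
      case True
      then show ?thesis
        using same[OF assms(1) x(2)] same[OF assms(2) x(2)] *(3) x y by (cases b; cases d) simp_all
    next
      case False
      have "U i \<inter> W j \<noteq> {}" "U' i \<inter> W' j \<noteq> {}"
        using nonempty(1)[OF _ y(2) x(2)] assms False by metis+
      then show ?thesis
        using nonempty[OF assms(1) x(2) y(2) False] nonempty[OF assms(2) x(2) y(2) False] x y
        by (cases b; cases d) simp_all
    qed
  qed (use cov assms in auto)
qed

text \<open>Each loop is cut into two halves \<open>L e\<close> and \<open>R e\<close> because \<open>Y \<inter> (L e \<union> R e)\<close> is disconnected and hence
  not an absolute retract.\<close>

definition loop_AR_cover ::
  "nat \<Rightarrow> 'a::euclidean_space set \<Rightarrow> (nat \<Rightarrow> 'a set) \<Rightarrow> (nat \<Rightarrow> 'a set) \<Rightarrow> bool" where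
  "loop_AR_cover N Y L R \<longleftrightarrow> closed Y \<and> AR Y \<and>
     (\<forall>e\<in>{1..N}. closed (L e) \<and> closed (R e) \<and> AR (L e) \<and> AR (R e) \<and> AR (Y \<inter> L e) \<and> AR (Y \<inter> R e)
        \<and> AR (L e \<inter> R e) \<and> Y \<inter> L e \<inter> R e = {}) \<and>
     (\<forall>e\<in>{1..N}. \<forall>e'\<in>{1..N}. e \<noteq> e' \<longrightarrow> (L e \<union> R e) \<inter> (L e' \<union> R e') = {})"

lemma loop_AR_covers_homotopy_eqv:
  fixes Y :: "'a::euclidean_space set" and Y' :: "'b::euclidean_space set"
  assumes "loop_AR_cover N Y L R" "loop_AR_cover N Y' L' R'"
  shows "(Y \<union> (\<Union>e\<in>{1..N}. L e \<union> R e)) homotopy_eqv (Y' \<union> (\<Union>e\<in>{1..N}. L' e \<union> R' e))"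
proof -
  \<comment> \<open>The index 0 is reserved for \<open>Y\<close>, which is why loops are numbered
    from 1; the Boolean selects a half of a loop, and only one value is kept for
    \<open>Y\<close>.\<close>
  define I where "I = insert (0,True) ({1..N} \<times> (UNIV :: bool set))"
  have Icases: "x = (0,True) \<or> (\<exists>e\<in>{1..N}. x = (e,True) \<or> x = (e,False))" if "x \<in> I" for x
    using that by (cases x; cases "snd x") (auto simp: I_def)
  have cov: "AR_cover I (\<lambda>(e,b). if e = 0 then Y else if b then L e else R e)"
    and eq: "(\<Union>x\<in>I. (\<lambda>(e,b). if e = 0 then Y else if b then L e else R e) x) = Y \<union> (\<Union>e\<in>{1..N}. L e \<union> R e)"
    and ne: "\<And>e e'. \<lbrakk>1 \<le> e; e \<le> N; 1 \<le> e'; e' \<le> N\<rbrakk> \<Longrightarrow> Y \<inter> L e \<noteq> {} \<and> Y \<inter> R e \<noteq> {} \<and> L e \<inter> Y \<noteq> {} \<and> R e \<inter> Y \<noteq> {} \<and>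
       L e \<inter> R e \<noteq> {} \<and> R e \<inter> L e \<noteq> {} \<and>
       (e \<noteq> e' \<longrightarrow> L e \<inter> L e' = {} \<and> L e \<inter> R e' = {} \<and> R e \<inter> L e' = {} \<and> R e \<inter> R e' = {})"
    if "loop_AR_cover N Y L R" for Y and L R :: "nat \<Rightarrow> 'c::euclidean_space set"
  proof -
    let ?F = "\<lambda>(e,b). if e = (0::nat) then Y else if b then L e else R e"
    have D: "L e \<inter> L e' = {}" "L e \<inter> R e' = {}" "R e \<inter> L e' = {}" "R e \<inter> R e' = {}"
      if "1 \<le> e" "e \<le> N" "1 \<le> e'" "e' \<le> N" "e \<noteq> e'" for e e'
    proof -
      have "(L e \<union> R e) \<inter> (L e' \<union> R e') = {}"
        using \<open>loop_AR_cover N Y L R\<close> that unfolding loop_AR_cover_def by simp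
      then show "L e \<inter> L e' = {}" "L e \<inter> R e' = {}" "R e \<inter> L e' = {}" "R e \<inter> R e' = {}" by blast+
    qed
    have A: "AR (L e)" "AR (R e)" "AR (Y \<inter> L e)" "AR (Y \<inter> R e)" "AR (L e \<inter> R e)" "Y \<inter> L e \<inter> R e = {}"
       "AR (L e \<inter> Y)" "AR (R e \<inter> Y)" "AR (R e \<inter> L e)" "closed (L e)" "closed (R e)"
      if "1 \<le> e" "e \<le> N" for e
      using \<open>loop_AR_cover N Y L R\<close> that unfolding loop_AR_cover_def by (auto simp: Int_commute)
    have Y: "AR Y" "closed Y" using that unfolding loop_AR_cover_def by auto
    have zero: "fst v \<noteq> 0" if "v \<in> I" "w \<in> I" "v \<noteq> w" "fst w = 0" for v w
      using that by (auto simp: I_def)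
    have far: "?F v \<inter> ?F w = {}" if "v \<in> I" "w \<in> I" "fst v \<noteq> 0" "fst w \<noteq> 0" "fst v \<noteq> fst w" for v w
      using that D[of "fst v" "fst w"] by (cases v; cases w; cases "snd v"; cases "snd w") (simp_all add: I_def)
    \<comment> \<open>The only three members that meet pairwise are \<open>Y\<close>,
      \<open>L e\<close>, \<open>R e\<close>, and for these emptiness is assumed.\<close>
    have tr: "?F x \<inter> ?F y \<inter> ?F z = {}" if "x \<in> I" "y \<in> I" "z \<in> I" "x \<noteq> y" "y \<noteq> z" "x \<noteq> z" for x y z
    proof -
      have S: "Y \<inter> R e \<inter> L e = {}" if "1 \<le> e" "e \<le> N" for e
        using A(6)[OF that] by auto
      have near: "?F u \<inter> ?F v \<inter> ?F w = {}"
        if "u \<in> I" "v \<in> I" "w \<in> I" "fst u = 0" "fst v = fst w" "v \<noteq> w" "fst v \<noteq> 0" for u v w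
        using that A(6)[of "fst v"] S[of "fst v"]
        by (cases u; cases v; cases w; cases "snd v"; cases "snd w") (simp_all add: I_def)
      note xyz = that
      show ?thesis
      proof (cases "fst x = 0 \<or> fst y = 0 \<or> fst z = 0")
        case True
        then consider "fst x = 0" "fst y \<noteq> 0" "fst z \<noteq> 0" | "fst y = 0" "fst x \<noteq> 0" "fst z \<noteq> 0"
          | "fst z = 0" "fst x \<noteq> 0" "fst y \<noteq> 0"
          using zero xyz by metis
        then show ?thesis
        proof cases
          case 1
          then show ?thesis using near[of x y z] far[of y z] that by blast
        next
          case 2
          then show ?thesis using near[of y x z] far[of x z] that by blast
        next
          case 3
          then show ?thesis using near[of z x y] far[of x y] that by blast
        qed
      next
        case False
        have "\<not> (fst x = fst y \<and> fst y = fst z)" using xyz by (cases x; cases y; cases z) auto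
        then show ?thesis using False far that by blast
      qed
    qed
    have pr: "?F x \<inter> ?F y = {} \<or> AR (?F x \<inter> ?F y)" if "x \<in> I" "y \<in> I" "x \<noteq> y" for x y
    proof (cases "fst x = 0 \<or> fst y = 0 \<or> fst x = fst y")
      case True
      then show ?thesis
        using Icases[OF that(1)] Icases[OF that(2)] that(3) A by (elim disjE bexE) simp_all
    next
      case False
      then show ?thesis using far that by blast
    qed
    have "finite I" by (simp add: I_def)
    moreover have "\<forall>x\<in>I. closed (?F x) \<and> AR (?F x)" using A Y by (auto simp: I_def)
    ultimately show "AR_cover I ?F" unfolding AR_cover_def using tr pr by blast
    have "\<And>x. x \<in> {1..N} \<times> UNIV \<Longrightarrow> ?F x = (if snd x then L (fst x) else R (fst x))" by auto
    then have "(\<Union>x\<in>{1..N} \<times> UNIV. ?F x) = (\<Union>x\<in>{1..N} \<times> UNIV. if snd x then L (fst x) else R (fst x))" by simp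
    also have "\<dots> = (\<Union>e\<in>{1..N}. L e \<union> R e)"
    proof (intro equalityI subsetI)
      fix v assume "v \<in> (\<Union>e\<in>{1..N}. L e \<union> R e)"
      then obtain e where "e \<in> {1..N}" "v \<in> L e \<or> v \<in> R e" by auto
      then show "v \<in> (\<Union>x\<in>{1..N} \<times> UNIV. if snd x then L (fst x) else R (fst x))"
        by (intro UN_I[of "(e, v \<in> L e)"]) auto
    qed (auto split: if_splits)
    finally show "(\<Union>x\<in>I. ?F x) = Y \<union> (\<Union>e\<in>{1..N}. L e \<union> R e)" unfolding I_def by simp
    show "\<And>e e'. \<lbrakk>1 \<le> e; e \<le> N; 1 \<le> e'; e' \<le> N\<rbrakk> \<Longrightarrow> Y \<inter> L e \<noteq> {} \<and> Y \<inter> R e \<noteq> {} \<and> L e \<inter> Y \<noteq> {} \<and> R e \<inter> Y \<noteq> {} \<and>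
       L e \<inter> R e \<noteq> {} \<and> R e \<inter> L e \<noteq> {} \<and>
       (e \<noteq> e' \<longrightarrow> L e \<inter> L e' = {} \<and> L e \<inter> R e' = {} \<and> R e \<inter> L e' = {} \<and> R e \<inter> R e' = {})"
      using A(3,4,5,7,8,9)[THEN AR_imp_nonempty] D by simp
  qed
  show ?thesis
    unfolding eq[OF assms(1), symmetric] eq[OF assms(2), symmetric]
  proof (rule AR_covers_homotopy_eqv)
    fix x y assume *: "x \<in> I" "y \<in> I" "x \<noteq> y"
    show "((case x of (e, b) \<Rightarrow> if e = 0 then Y else if b then L e else R e) \<inter> (case y of (e, b) \<Rightarrow> if e = 0 then Y else if b then L e else R e) = {}) =
       ((case x of (e, b) \<Rightarrow> if e = 0 then Y' else if b then L' e else R' e) \<inter> (case y of (e, b) \<Rightarrow> if e = 0 then Y' else if b then L' e else R' e) = {})"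
    proof (cases "fst x = 0 \<or> fst y = 0")
      case True
      then show ?thesis
        using Icases[OF *(1)] Icases[OF *(2)] *(3) ne[OF assms(1), of "fst x" "fst x"] ne[OF assms(2), of "fst x" "fst x"]
          ne[OF assms(1), of "fst y" "fst y"] ne[OF assms(2), of "fst y" "fst y"]
        by (elim disjE bexE) simp_all
    next
      case False
      then show ?thesis
        using Icases[OF *(1)] Icases[OF *(2)] *(3) ne[OF assms(1), of "fst x" "fst y"] ne[OF assms(2), of "fst x" "fst y"]
        by (cases "fst x = fst y"; elim disjE bexE) simp_all
    qed
  qed (use cov assms in auto)
qed

section \<open>The bouquet of circles\<close>

text \<open>The projection \<open>Im\<close> inverts the parametrization, so the graph is
  homeomorphic to an interval.\<close>

lemma AR_graph_over_Im:
  assumes "a \<le> b" "continuous_on {a..b} f"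
  shows "AR ((\<lambda>t. Complex (f t) t) ` {a..b})" "closed ((\<lambda>t. Complex (f t) t) ` {a..b})"
proof -
  have c: "continuous_on {a..b} (\<lambda>t. Complex (f t) t)"
    by (intro continuous_intros assms continuous_on_Complex) 
  have "homeomorphism {a..b} ((\<lambda>t. Complex (f t) t) ` {a..b}) (\<lambda>t. Complex (f t) t) Im"
    unfolding homeomorphism_def using c by (auto intro!: continuous_intros simp: image_image)
  then have "((\<lambda>t. Complex (f t) t) ` {a..b}) homeomorphic {a..b}"
    using homeomorphic_def homeomorphic_sym by blast
  moreover have "AR {a..b}" using assms by (intro convex_imp_AR) auto
  ultimately show "AR ((\<lambda>t. Complex (f t) t) ` {a..b})" using AR_homeomorphic_AR by blast
  show "closed ((\<lambda>t. Complex (f t) t) ` {a..b})"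
    using compact_continuous_image[OF c] by (simp add: compact_imp_closed)
qed

text \<open>The equation is that of the circle with centre and radius \<open>e\<close>. Cutting at
  \<open>Re z = e\<close> and at the point \<open>2 * e\<close> gives a half through the wedge point
  0 and two quarters away from it: the halves will form the hub, the quarters the two parts of each
  loop.\<close>

definition left_arc :: "nat \<Rightarrow> complex set" where
  "left_arc e = {z. (Re z)\<^sup>2 + (Im z)\<^sup>2 = 2 * e * Re z \<and> Re z \<le> e}"
definition upper_arc :: "nat \<Rightarrow> complex set" where
  "upper_arc e = {z. (Re z)\<^sup>2 + (Im z)\<^sup>2 = 2 * e * Re z \<and> Re z \<ge> e \<and> Im z \<ge> 0}"
definition lower_arc :: "nat \<Rightarrow> complex set" where
  "lower_arc e = {z. (Re z)\<^sup>2 + (Im z)\<^sup>2 = 2 * e * Re z \<and> Re z \<ge> e \<and> Im z \<le> 0}"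

lemma sphere_eq_arcs: "sphere (of_nat e) (of_nat e) = left_arc e \<union> upper_arc e \<union> lower_arc e"
proof -
  have "z \<in> sphere (of_nat e) (of_nat e) \<longleftrightarrow> (Re z)\<^sup>2 + (Im z)\<^sup>2 = 2 * e * Re z" for z :: complex
  proof -
    have "z \<in> sphere (of_nat e) (of_nat e) \<longleftrightarrow> sqrt ((e - Re z)\<^sup>2 + (Im z)\<^sup>2) = e"
      by (simp add: dist_norm cmod_def)
    also have "\<dots> \<longleftrightarrow> (e - Re z)\<^sup>2 + (Im z)\<^sup>2 = (real e)\<^sup>2"
      by (metis of_nat_0_le_iff real_sqrt_eq_iff real_sqrt_unique sqrt_ge_absD real_sqrt_abs abs_of_nonneg)
    also have "\<dots> \<longleftrightarrow> (Re z)\<^sup>2 + (Im z)\<^sup>2 = 2 * e * Re z"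
      by (auto simp: power2_eq_square algebra_simps)
    finally show ?thesis .
  qed
  then have "sphere (of_nat e) (of_nat e) = {z. (Re z)\<^sup>2 + (Im z)\<^sup>2 = 2 * e * Re z}"
    by (intro set_eqI) (simp only: mem_Collect_eq)
  also have "\<dots> = left_arc e \<union> upper_arc e \<union> lower_arc e"
    unfolding left_arc_def upper_arc_def lower_arc_def by (intro set_eqI) (simp; linarith)
  finally show ?thesis .
qed

lemma arcs_as_graphs:
  "left_arc e = (\<lambda>t. Complex (real e - sqrt ((real e)\<^sup>2 - t\<^sup>2)) t) ` {- real e..real e}"
  "upper_arc e = (\<lambda>t. Complex (real e + sqrt ((real e)\<^sup>2 - t\<^sup>2)) t) ` {0..real e}"
  "lower_arc e = (\<lambda>t. Complex (real e + sqrt ((real e)\<^sup>2 - t\<^sup>2)) t) ` {- real e..0}"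
proof -
  have circ: "(Re z)\<^sup>2 + (Im z)\<^sup>2 = 2 * e * Re z \<longleftrightarrow> ((real e)\<^sup>2 - (Im z)\<^sup>2) = (Re z - e)\<^sup>2" for z
    by (auto simp: power2_eq_square algebra_simps)
  have bound: "\<bar>Im z\<bar> \<le> e" if "(Re z)\<^sup>2 + (Im z)\<^sup>2 = 2 * e * Re z" for z
  proof -
    have "(real e)\<^sup>2 - (Im z)\<^sup>2 \<ge> 0" using that circ[of z] by simp
    then have "(Im z)\<^sup>2 \<le> (real e)\<^sup>2" by simp
    then show ?thesis by (metis abs_le_square_iff abs_of_nat)
  qed
  have nn: "t\<^sup>2 \<le> (real e)\<^sup>2" if "- real e \<le> t" "t \<le> real e" for t
    using that by (metis abs_le_iff abs_le_square_iff abs_of_nat minus_le_iff)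
  have key: "(e + s)\<^sup>2 + t\<^sup>2 = 2 * e * (e + s) \<and> (e - s)\<^sup>2 + t\<^sup>2 = 2 * e * (e - s)"
    if "s = sqrt ((real e)\<^sup>2 - t\<^sup>2)" "- real e \<le> t" "t \<le> real e" for s t :: real
  proof -
    have "s\<^sup>2 = (real e)\<^sup>2 - t\<^sup>2" using that nn[of t] by simp
    then show ?thesis by (simp add: power2_eq_square algebra_simps)
  qed
  show "left_arc e = (\<lambda>t. Complex (real e - sqrt ((real e)\<^sup>2 - t\<^sup>2)) t) ` {- real e..real e}"
  proof (intro equalityI subsetI)
    fix z assume z: "z \<in> left_arc e"
    then have "sqrt ((real e)\<^sup>2 - (Im z)\<^sup>2) = e - Re z" using circ[of z] by (auto simp: left_arc_def)
    then have "z = Complex (real e - sqrt ((real e)\<^sup>2 - (Im z)\<^sup>2)) (Im z)" by simp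
    moreover have "Im z \<in> {- real e..real e}" using z bound[of z] by (auto simp: left_arc_def)
    ultimately show "z \<in> (\<lambda>t. Complex (real e - sqrt ((real e)\<^sup>2 - t\<^sup>2)) t) ` {- real e..real e}" by blast
  next
    fix z assume "z \<in> (\<lambda>t. Complex (real e - sqrt ((real e)\<^sup>2 - t\<^sup>2)) t) ` {- real e..real e}"
    then show "z \<in> left_arc e" using nn key by (auto simp: left_arc_def)
  qed
  show "upper_arc e = (\<lambda>t. Complex (real e + sqrt ((real e)\<^sup>2 - t\<^sup>2)) t) ` {0..real e}"
  proof (intro equalityI subsetI)
    fix z assume z: "z \<in> upper_arc e"
    then have "sqrt ((real e)\<^sup>2 - (Im z)\<^sup>2) = Re z - e" using circ[of z] by (auto simp: upper_arc_def)
    then have "z = Complex (real e + sqrt ((real e)\<^sup>2 - (Im z)\<^sup>2)) (Im z)" by simp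
    moreover have "Im z \<in> {0..real e}" using z bound[of z] by (auto simp: upper_arc_def)
    ultimately show "z \<in> (\<lambda>t. Complex (real e + sqrt ((real e)\<^sup>2 - t\<^sup>2)) t) ` {0..real e}" by blast
  next
    fix z assume "z \<in> (\<lambda>t. Complex (real e + sqrt ((real e)\<^sup>2 - t\<^sup>2)) t) ` {0..real e}"
    then show "z \<in> upper_arc e" using nn key by (auto simp: upper_arc_def)
  qed
  show "lower_arc e = (\<lambda>t. Complex (real e + sqrt ((real e)\<^sup>2 - t\<^sup>2)) t) ` {- real e..0}"
  proof (intro equalityI subsetI)
    fix z assume z: "z \<in> lower_arc e"
    then have "sqrt ((real e)\<^sup>2 - (Im z)\<^sup>2) = Re z - e" using circ[of z] by (auto simp: lower_arc_def)
    then have "z = Complex (real e + sqrt ((real e)\<^sup>2 - (Im z)\<^sup>2)) (Im z)" by simp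
    moreover have "Im z \<in> {- real e..0}" using z bound[of z] by (auto simp: lower_arc_def)
    ultimately show "z \<in> (\<lambda>t. Complex (real e + sqrt ((real e)\<^sup>2 - t\<^sup>2)) t) ` {- real e..0}" by blast
  next
    fix z assume "z \<in> (\<lambda>t. Complex (real e + sqrt ((real e)\<^sup>2 - t\<^sup>2)) t) ` {- real e..0}"
    then show "z \<in> lower_arc e" using nn key by (auto simp: lower_arc_def)
  qed
qed

lemma AR_arcs:
  "AR (left_arc e)" "AR (upper_arc e)" "AR (lower_arc e)"
  "closed (left_arc e)" "closed (upper_arc e)" "closed (lower_arc e)"
  unfolding arcs_as_graphs by (intro AR_graph_over_Im continuous_intros; simp)+

lemma distinct_circles_meet_at_0:
  assumes "(Re z)\<^sup>2 + (Im z)\<^sup>2 = 2 * real e * Re z" "(Re z)\<^sup>2 + (Im z)\<^sup>2 = 2 * real e' * Re z" "e \<noteq> e'"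
  shows "z = 0"
proof -
  have "(real e - real e') * Re z = 0" using assms(1,2) by (simp add: algebra_simps)
  then have "Re z = 0" using assms(3) by simp
  then show ?thesis using assms(1) by (simp add: complex_eq_iff)
qed

lemma bouquet_loop_AR_cover:
  assumes "1 \<le> N"
  shows "loop_AR_cover N (\<Union>e\<in>{1..N}. left_arc e) upper_arc lower_arc"
    and "bouquet N = (\<Union>e\<in>{1..N}. left_arc e) \<union> (\<Union>e\<in>{1..N}. upper_arc e \<union> lower_arc e)"
proof -
  show "bouquet N = (\<Union>e\<in>{1..N}. left_arc e) \<union> (\<Union>e\<in>{1..N}. upper_arc e \<union> lower_arc e)"
    unfolding bouquet_def sphere_eq_arcs by blast
  let ?Y = "\<Union>e\<in>{1..N}. left_arc e"
  have zero: "0 \<in> left_arc e" for e by (simp add: left_arc_def)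
  \<comment> \<open>The left halves meet pairwise only in the wedge point, which serves as hub;
    adding it changes nothing because there is at least one circle.\<close>
  have "AR ({0} \<union> ?Y)"
  proof (rule AR_Un_family)
    show "AR ({0} \<inter> left_arc e)" for e using zero[of e] by (simp add: AR_singleton)
    show "left_arc e \<inter> left_arc e' \<subseteq> {0}" if "e \<noteq> e'" for e e'
      using distinct_circles_meet_at_0[OF _ _ that] by (auto simp: left_arc_def)
  qed (auto simp: AR_singleton AR_arcs)
  moreover have "{0} \<union> ?Y = ?Y" using zero assms by auto
  ultimately have Y: "AR ?Y" by simp
  have pt: "?Y \<inter> upper_arc e = {Complex e e}" "?Y \<inter> lower_arc e = {Complex e (- real e)}"
    "upper_arc e \<inter> lower_arc e = {Complex (2*e) 0}" if e: "e \<in> {1..N}" for e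
  proof -
    have same: "e' = e" if "z \<in> left_arc e'" "z \<in> upper_arc e \<union> lower_arc e" for z e'
    proof (rule ccontr)
      assume "e' \<noteq> e"
      then have "z = 0" using that distinct_circles_meet_at_0[of z e e']
        by (auto simp: left_arc_def upper_arc_def lower_arc_def)
      then show False using that e by (auto simp: upper_arc_def lower_arc_def)
    qed
    have im: "Im z = e \<or> Im z = - real e" if "(Re z)\<^sup>2 + (Im z)\<^sup>2 = 2 * e * Re z" "Re z = e" for z
    proof -
      have "(Im z)\<^sup>2 = (real e)\<^sup>2" using that by (simp add: power2_eq_square)
      then show ?thesis by (simp add: power2_eq_iff)
    qed
    have "left_arc e \<inter> upper_arc e = {Complex e e}"
    proof (intro equalityI subsetI)
      fix z assume "z \<in> left_arc e \<inter> upper_arc e"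
      then show "z \<in> {Complex e e}" using im[of z] by (auto simp: left_arc_def upper_arc_def complex_eq_iff)
    qed (auto simp: left_arc_def upper_arc_def power2_eq_square)
    moreover have "left_arc e \<inter> lower_arc e = {Complex e (- real e)}"
    proof (intro equalityI subsetI)
      fix z assume "z \<in> left_arc e \<inter> lower_arc e"
      then show "z \<in> {Complex e (- real e)}" using im[of z] by (auto simp: left_arc_def lower_arc_def complex_eq_iff)
    qed (auto simp: left_arc_def lower_arc_def power2_eq_square)
    moreover have "?Y \<inter> upper_arc e = left_arc e \<inter> upper_arc e" "?Y \<inter> lower_arc e = left_arc e \<inter> lower_arc e"
      using same e by blast+
    ultimately show "?Y \<inter> upper_arc e = {Complex e e}" "?Y \<inter> lower_arc e = {Complex e (- real e)}" by auto
    show "upper_arc e \<inter> lower_arc e = {Complex (2*e) 0}"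
      using e by (auto simp: upper_arc_def lower_arc_def complex_eq_iff power2_eq_square)
  qed
  have "(upper_arc e \<union> lower_arc e) \<inter> (upper_arc e' \<union> lower_arc e') = {}"
    if "e \<in> {1..N}" "e' \<in> {1..N}" "e \<noteq> e'" for e e'
  proof -
    have False if z: "z \<in> upper_arc e \<union> lower_arc e" "z \<in> upper_arc e' \<union> lower_arc e'" for z
    proof -
      have "z = 0" using z distinct_circles_meet_at_0[OF _ _ \<open>e \<noteq> e'\<close>, of z]
        by (auto simp: upper_arc_def lower_arc_def)
      then show False using z \<open>e \<in> {1..N}\<close> by (auto simp: upper_arc_def lower_arc_def)
    qed
    then show ?thesis by blast
  qed
  moreover have "?Y \<inter> upper_arc e \<inter> lower_arc e = {}" if "e \<in> {1..N}" for e
    using pt(1)[OF that] that by (auto simp: lower_arc_def)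
  ultimately show "loop_AR_cover N ?Y upper_arc lower_arc"
    unfolding loop_AR_cover_def using Y pt by (auto simp: AR_arcs AR_singleton intro!: closed_UN)
qed

section \<open>The crown graph and a spanning tree of it\<close>

text \<open>An edge \<open>(i, j)\<close> joins \<open>W\<^sub>i\<close> to \<open>U\<^sub>j\<close>.\<close>

definition crown_edges :: "nat \<Rightarrow> (nat \<times> nat) set" where
  "crown_edges n = {(i,j). i < n \<and> j < n \<and> i \<noteq> j}"

text \<open>The sets \<open>U j\<close> with \<open>j \<ge> 1\<close> are hung on
  \<open>W 1\<close>, except that \<open>U 1\<close> does not meet \<open>W 1\<close> and goes to
  \<open>W 2\<close>, which needs a third branch.\<close>

definition crown_tree_parent :: "nat \<Rightarrow> nat" where
  "crown_tree_parent j = (if j = 1 then 2 else 1)"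

text \<open>A spanning tree with 2n - 1 edges on 2n vertices: \<open>U 0\<close> is the root, and
  \<open>W 0\<close>, which does not meet it, hangs on \<open>U 1\<close>.\<close>

definition crown_tree :: "nat \<Rightarrow> (nat \<times> nat) set" where
  "crown_tree n = insert (0,1) ((\<lambda>i. (i,0)) ` {1..<n} \<union> (\<lambda>j. (crown_tree_parent j, j)) ` {1..<n})"

lemma crown_tree_subset: "3 \<le> n \<Longrightarrow> crown_tree n \<subseteq> crown_edges n"
  by (auto simp: crown_tree_def crown_edges_def crown_tree_parent_def split: if_splits)

lemma card_crown_non_tree:
  assumes "3 \<le> n"
  shows "card (crown_edges n - crown_tree n) = n^2 - 3*n + 1"
proof -
  have "card (crown_tree n) = 2 * n - 1"
  proof -
    have 1: "card ((\<lambda>i. (i,0::nat)) ` {1..<n}) = n - 1" by (subst card_image) (auto simp: inj_on_def)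
    have 2: "card ((\<lambda>j. (crown_tree_parent j, j)) ` {1..<n}) = n - 1"
      by (subst card_image) (auto simp: inj_on_def)
    have "card ((\<lambda>i. (i,0)) ` {1..<n} \<union> (\<lambda>j. (crown_tree_parent j, j)) ` {1..<n}) = (n - 1) + (n - 1)"
      by (subst card_Un_disjoint) (use 1 2 in auto)
    moreover have "(0,1) \<notin> (\<lambda>i. (i,0::nat)) ` {1..<n} \<union> (\<lambda>j. (crown_tree_parent j, j)) ` {1..<n}"
      by (auto simp: crown_tree_parent_def)
    ultimately show ?thesis using assms unfolding crown_tree_def by (subst card_insert_disjoint) auto
  qed
  moreover have "card (crown_edges n) = n * n - n"
  proof -
    have "crown_edges n = {..<n} \<times> {..<n} - (\<lambda>i. (i,i)) ` {..<n}" by (auto simp: crown_edges_def)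
    moreover have "card ((\<lambda>i. (i,i)) ` {..<n}) = n" by (subst card_image) (auto simp: inj_on_def)
    ultimately show ?thesis by (simp add: card_Diff_subset image_subset_iff)
  qed
  moreover have "card (crown_edges n - crown_tree n) = card (crown_edges n) - card (crown_tree n)"
    by (rule card_Diff_subset[OF _ crown_tree_subset[OF assms]]) (simp add: crown_tree_def)
  moreover have "n * n - n - (2 * n - 1) = n^2 - 3*n + 1"
  proof -
    \<comment> \<open>The bound \<open>3 * n \<le> m\<close> keeps the subtractions on natural
      numbers from truncating.\<close>
    have "m - n - (2 * n - 1) = m - 3 * n + 1" if "3 * n \<le> m" for m using that assms by linarith
    then show ?thesis using assms by (simp add: power2_eq_square)
  qed
  ultimately show ?thesis by simp
qed

section \<open>The double mapping cylinder\<close>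

text \<open>In the cylinder the \<open>U j\<close> sit at level 0 and the \<open>W i\<close> at
  level 1, joined only through the cylinders over the overlaps. The part over the spanning tree is
  then an absolute retract, and each remaining cylinder is a handle attached to it at both
  ends.\<close>

lemma bipartite_AR_cover_homotopy_eqv_bouquet:
  fixes U W :: "nat \<Rightarrow> 'a::euclidean_space set"
  assumes n: "3 \<le> n" and cov: "bipartite_AR_cover n U W"
  shows "((\<Union>i<n. U i) \<union> (\<Union>i<n. W i)) homotopy_eqv bouquet (n^2 - 3*n + 1)"
proof -
  define J where "J = (\<lambda>(i,j). U j \<inter> W i)"
  have U: "closed (U i)" "AR (U i)" and W: "closed (W i)" "AR (W i)" if "i < n" for i
    using cov that unfolding bipartite_AR_cover_def by auto
  have J: "closed (J e)" "AR (J e)" if "e \<in> crown_edges n" for e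
    using cov that unfolding bipartite_AR_cover_def J_def crown_edges_def by auto
  have uU: "i = j" if "x \<in> U i" "x \<in> U j" "i < n" "j < n" for x i j
    using cov that unfolding bipartite_AR_cover_def by (metis IntI empty_iff)
  have uW: "i = j" if "x \<in> W i" "x \<in> W j" "i < n" "j < n" for x i j
    using cov that unfolding bipartite_AR_cover_def by (metis IntI empty_iff)
  have uUW: "False" if "x \<in> U i" "x \<in> W i" "i < n" for x i
    using cov that unfolding bipartite_AR_cover_def by auto
  have AR01: "AR {0..1::real}" "AR {0..1/2::real}" "AR {1/2..1::real}" "AR {1::real}" "AR {0::real}" "AR {1/2::real}"
    by (auto intro: convex_imp_AR)
  have cyl: "AR (J e \<times> {0..1::real} \<union> U (snd e) \<times> {0})" "AR (J e \<times> {0..1::real} \<union> W (fst e) \<times> {1})"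
    if "e \<in> crown_edges n" for e
  proof -
    have e: "fst e < n" "snd e < n" using that by (auto simp: crown_edges_def)
    have "J e \<times> {0..1} \<inter> U (snd e) \<times> {0} = J e \<times> {0::real}" "J e \<times> {0..1} \<inter> W (fst e) \<times> {1} = J e \<times> {1::real}"
      by (auto simp: J_def)
    then show "AR (J e \<times> {0..1::real} \<union> U (snd e) \<times> {0})" "AR (J e \<times> {0..1::real} \<union> W (fst e) \<times> {1})"
      using J[OF that] U[OF e(2)] W[OF e(1)] AR01 by (auto intro!: AR_closed_Un AR_Times closed_Times)
  qed
  have ccyl: "closed (J e \<times> {0..1::real} \<union> U (snd e) \<times> {0})" "closed (J e \<times> {0..1::real} \<union> W (fst e) \<times> {1})"
    if "e \<in> crown_edges n" for e
  proof -
    have e: "fst e < n" "snd e < n" using that by (auto simp: crown_edges_def)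
    then show "closed (J e \<times> {0..1::real} \<union> U (snd e) \<times> {0})" "closed (J e \<times> {0..1::real} \<union> W (fst e) \<times> {1})"
      using J[OF that] U[OF e(2)] W[OF e(1)] by (auto intro!: closed_Un closed_Times)
  qed
  \<comment> \<open>The double mapping cylinder of the inclusions of \<open>U\<^sub>j \<inter> W\<^sub>i\<close>, covered first by \<open>U'\<close> and \<open>W'\<close>.\<close>
  define U' where "U' j = U j \<times> {0::real} \<union> (\<Union>i\<in>{..<n}-{j}. J (i,j) \<times> {0..1})" for j
  define W' where "W' i = W i \<times> {1::real}" for i
  have U'U: "fst y \<in> U j" if "y \<in> U' j" for y j using that by (auto simp: U'_def J_def)
  have cov': "bipartite_AR_cover n U' W'"
  proof -
    have "AR (U' j)" "closed (U' j)" if "j < n" for j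
    proof -
      show "AR (U' j)" unfolding U'_def
      proof (rule AR_Un_family)
        show "AR (U j \<times> {0} \<inter> J (i, j) \<times> {0..1::real})" if "i \<in> {..<n}-{j}" for i
        proof -
          have "U j \<times> {0} \<inter> J (i, j) \<times> {0..1} = J (i,j) \<times> {0::real}" by (auto simp: J_def)
          then show ?thesis using J(2)[of "(i,j)"] that \<open>j < n\<close> by (auto simp: crown_edges_def intro!: AR_Times AR01)
        qed
        show "J (i, j) \<times> {0..1} \<inter> J (k, j) \<times> {0..1} \<subseteq> U j \<times> {0::real}"
          if "i \<in> {..<n}-{j}" "k \<in> {..<n}-{j}" "i \<noteq> k" for i k
          using that uW by (auto simp: J_def)
      qed (use that U J in \<open>auto simp: crown_edges_def intro!: AR_Times AR01 closed_Times\<close>)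
      show "closed (U' j)" unfolding U'_def
        using that U J by (auto simp: crown_edges_def intro!: closed_Un closed_UN closed_Times)
    qed
    moreover have "AR (W' i)" "closed (W' i)" if "i < n" for i
      using W[OF that] by (auto simp: W'_def intro!: AR_Times AR01 closed_Times)
    moreover have "U' i \<inter> W' i = {}" if "i < n" for i
      using uUW[OF _ _ that] U'U[of _ i] by (fastforce simp: W'_def)
    moreover have "U' i \<inter> U' j = {}" if "i < n" "j < n" "i \<noteq> j" for i j
      using uU[OF _ _ that(1,2)] U'U[of _ i] U'U[of _ j] that(3) by blast
    moreover have "W' i \<inter> W' j = {}" if "i < n" "j < n" "i \<noteq> j" for i j
      using uW[OF _ _ that(1,2)] that(3) by (auto simp: W'_def)
    moreover have "AR (U' j \<inter> W' i)" if "i < n" "j < n" "i \<noteq> j" for i j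
    proof -
      \<comment> \<open>All cylinders belong to the \<open>U'\<close> side, so the two sides meet
        only in the upper ends.\<close>
      have "U' j \<inter> W' i = J (i,j) \<times> {1}"
      proof (intro equalityI subsetI)
        fix y assume "y \<in> U' j \<inter> W' i"
        then show "y \<in> J (i,j) \<times> {1}" using U'U[of y j] by (auto simp: W'_def J_def)
      next
        fix y assume y: "y \<in> J (i,j) \<times> {1::real}"
        then have "y \<in> (\<Union>i\<in>{..<n}-{j}. J (i,j) \<times> {0..1})" using that by (intro UN_I[of i]) auto
        then show "y \<in> U' j \<inter> W' i" using y by (auto simp: U'_def W'_def J_def)
      qed
      then show ?thesis using J(2)[of "(i,j)"] that by (auto simp: crown_edges_def intro!: AR_Times AR01)
    qed
    ultimately show ?thesis unfolding bipartite_AR_cover_def by simp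
  qed
  \<comment> \<open>The part over the spanning tree, grown from \<open>U\<^sub>0\<close> by adding \<open>W\<^sub>1, W\<^sub>2, \<dots>\<close>, then \<open>U\<^sub>1, U\<^sub>2, \<dots>\<close>, then \<open>W\<^sub>0\<close>.\<close>
  define Y1 where "Y1 = U 0 \<times> {0::real} \<union> (\<Union>i\<in>{1..<n}. J (i,0) \<times> {0..1} \<union> W i \<times> {1})"
  define Y2 where "Y2 = Y1 \<union> (\<Union>j\<in>{1..<n}. J (crown_tree_parent j,j) \<times> {0..1} \<union> U j \<times> {0})"
  define Y where "Y = Y2 \<union> (J (0,1) \<times> {0..1} \<union> W 0 \<times> {1})"
  have ed: "(i,0) \<in> crown_edges n" "(crown_tree_parent i,i) \<in> crown_edges n" if "i \<in> {1..<n}" for i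
    using that n by (auto simp: crown_edges_def crown_tree_parent_def)
  have ed01: "(0,1) \<in> crown_edges n" using n by (auto simp: crown_edges_def)
  have par: "crown_tree_parent j \<in> {1..<n}" for j using n by (auto simp: crown_tree_parent_def)
  have Y1: "AR Y1" "closed Y1"
  proof -
    show "AR Y1" unfolding Y1_def
    proof (rule AR_Un_family)
      fix i assume i: "i \<in> {1..<n}"
      have "U 0 \<times> {0} \<inter> (J (i, 0) \<times> {0..1} \<union> W i \<times> {1}) = J (i,0) \<times> {0::real}" by (auto simp: J_def)
      then show "AR (U 0 \<times> {0} \<inter> (J (i, 0) \<times> {0..1::real} \<union> W i \<times> {1}))"
        using J ed i by (auto intro!: AR_Times AR01)
      show "AR (J (i, 0) \<times> {0..1::real} \<union> W i \<times> {1})" "closed (J (i, 0) \<times> {0..1::real} \<union> W i \<times> {1})"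
        using cyl(2) ccyl(2) ed(1)[OF i] by fastforce+
      show "(J (i, 0) \<times> {0..1} \<union> W i \<times> {1}) \<inter> (J (j, 0) \<times> {0..1} \<union> W j \<times> {1}) \<subseteq> U 0 \<times> {0::real}"
        if "j \<in> {1..<n}" "i \<noteq> j" for j
        using that i uW[of _ i j] by (auto simp: J_def)
    qed (use U n in \<open>auto intro!: AR_Times AR01 closed_Times\<close>)
    show "closed Y1" unfolding Y1_def
      using U[of 0] W J ed n by (auto intro!: closed_Un closed_UN closed_Times)
  qed
  have Y2: "AR Y2" "closed Y2"
  proof -
    show "AR Y2" unfolding Y2_def
    proof (rule AR_Un_family)
      fix j assume j: "j \<in> {1..<n}"
      let ?k = "crown_tree_parent j"
      \<comment> \<open>\<open>U j\<close> is disjoint from \<open>U 0\<close>, so a common point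
        can come only from some \<open>W i\<close> at level 1; there the new part consists of the
        end of its cylinder.\<close>
      have "Y1 \<inter> (J (?k, j) \<times> {0..1} \<union> U j \<times> {0}) = J (?k,j) \<times> {1::real}"
      proof (intro equalityI subsetI)
        fix y assume y: "y \<in> Y1 \<inter> (J (?k, j) \<times> {0..1} \<union> U j \<times> {0})"
        then have yU: "fst y \<in> U j" by (auto simp: J_def)
        then have "fst y \<notin> U 0" using uU[of _ 0 j] j n by auto
        then obtain i where i: "i \<in> {1..<n}" "y \<in> W i \<times> {1}" using y by (auto simp: Y1_def J_def)
        then have "y \<in> J (?k, j) \<times> {0..1}" using y by auto
        then show "y \<in> J (?k,j) \<times> {1}" using i by auto
      next
        fix y assume "y \<in> J (?k,j) \<times> {1::real}"
        then show "y \<in> Y1 \<inter> (J (?k, j) \<times> {0..1} \<union> U j \<times> {0})"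
          using par[of j] by (auto simp: Y1_def J_def)
      qed
      then show "AR (Y1 \<inter> (J (?k, j) \<times> {0..1} \<union> U j \<times> {0}))"
        using J ed j by (auto intro!: AR_Times AR01)
      show "AR (J (?k, j) \<times> {0..1::real} \<union> U j \<times> {0})" "closed (J (?k, j) \<times> {0..1::real} \<union> U j \<times> {0})"
        using cyl(1) ccyl(1) ed(2)[OF j] by fastforce+
      show "(J (?k, j) \<times> {0..1} \<union> U j \<times> {0}) \<inter> (J (crown_tree_parent i, i) \<times> {0..1} \<union> U i \<times> {0}) \<subseteq> Y1"
        if "i \<in> {1..<n}" "j \<noteq> i" for i
        using that j uU[of _ i j] by (auto simp: J_def)
    qed (use Y1 in auto)
    show "closed Y2" unfolding Y2_def
      using Y1 U J ed n by (auto intro!: closed_Un closed_UN closed_Times)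
  qed
  have Y: "AR Y" "closed Y"
  proof -
    \<comment> \<open>\<open>W 0\<close> is disjoint from \<open>U 0\<close> and from every other
      \<open>W i\<close>; what is left of \<open>Y2\<close> lies at level 0.\<close>
    have int: "Y2 \<inter> (J (0,1) \<times> {0..1} \<union> W 0 \<times> {1}) = J (0,1) \<times> {0::real}"
    proof (intro equalityI subsetI)
      fix y assume y: "y \<in> Y2 \<inter> (J (0,1) \<times> {0..1} \<union> W 0 \<times> {1})"
      then have yW: "fst y \<in> W 0" by (auto simp: J_def)
      then have notW: "fst y \<notin> W i" if "i \<in> {1..<n}" for i using uW[of _ 0 i] that by auto
      have "fst y \<notin> U 0" using uUW[OF _ yW] n by auto
      then have "y \<notin> Y1" using notW by (auto simp: Y1_def J_def)
      then obtain j where j: "j \<in> {1..<n}" "y \<in> U j \<times> {0}"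
        using y notW par by (fastforce simp: Y2_def J_def)
      then show "y \<in> J (0,1) \<times> {0}" using y by auto
    next
      fix y assume "y \<in> J (0,1) \<times> {0::real}"
      then show "y \<in> Y2 \<inter> (J (0,1) \<times> {0..1} \<union> W 0 \<times> {1})"
        using n by (auto simp: Y2_def J_def intro!: bexI[of _ 1])
    qed
    show "AR Y" unfolding Y_def
    proof (rule AR_closed_Un)
      show "AR (Y2 \<inter> (J (0,1) \<times> {0..1} \<union> W 0 \<times> {1}))"
        unfolding int using J[OF ed01] by (intro AR_Times AR01) auto
    qed (use Y2 cyl(2)[OF ed01] ccyl(2)[OF ed01] in auto)
    show "closed Y" unfolding Y_def using Y2 ccyl(2)[OF ed01] by auto
  qed
  have Yeq: "Y = (\<Union>j<n. U j \<times> {0}) \<union> (\<Union>i<n. W i \<times> {1}) \<union> (\<Union>e\<in>crown_tree n. J e \<times> {0..1})"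
  proof -
    have "{..<n} = insert 0 {1..<n}" using n by auto
    then show ?thesis unfolding Y_def Y2_def Y1_def crown_tree_def by auto
  qed
  define N where "N = n^2 - 3*n + 1"
  have "finite (crown_edges n - crown_tree n)"
    by (rule finite_subset[of _ "{..<n} \<times> {..<n}"]) (auto simp: crown_edges_def)
  then obtain \<epsilon> where "bij_betw \<epsilon> {0..<N} (crown_edges n - crown_tree n)"
    using ex_bij_betw_nat_finite[of "crown_edges n - crown_tree n"] card_crown_non_tree[OF n] N_def by auto
  \<comment> \<open>Shift from the numbering from 0 to the numbering of loops from 1.\<close>
  moreover have "bij_betw (\<lambda>e. e - 1) {1..N} {0..<N}"
    by (rule bij_betw_byWitness[of _ Suc]) auto
  ultimately obtain \<eta> where \<eta>: "bij_betw \<eta> {1..N} (crown_edges n - crown_tree n)"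
    using bij_betw_trans by blast
  have \<eta>in: "\<eta> e \<in> crown_edges n" "\<eta> e \<notin> crown_tree n" if "e \<in> {1..N}" for e
    using bij_betwE[OF \<eta>] that by blast+
  have uJ: "e = e'" if "x \<in> J e" "x \<in> J e'" "e \<in> crown_edges n" "e' \<in> crown_edges n" for x e e'
    using that uU[of x "snd e" "snd e'"] uW[of x "fst e" "fst e'"] by (auto simp: J_def crown_edges_def)
  define L where "L e = J (\<eta> e) \<times> {0..1/2::real}" for e
  define R where "R e = J (\<eta> e) \<times> {1/2..1::real}" for e
  have loop: "loop_AR_cover N Y L R"
  proof -
    \<comment> \<open>Overlaps belonging to different edges are disjoint, so \<open>Y\<close> can
      contain only the two ends of a cylinder outside the tree.\<close>
    have notY: "y \<notin> (\<Union>e\<in>crown_tree n. J e \<times> {0..1})" if "e \<in> {1..N}" "fst y \<in> J (\<eta> e)" for e and y :: "'a \<times> real"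
      using uJ[OF that(2) _ \<eta>in(1)[OF that(1)]] \<eta>in(2)[OF that(1)] crown_tree_subset[OF n] by auto
    have Jm: "fst y \<in> U (snd (\<eta> e))" "fst y \<in> W (fst (\<eta> e))" "fst (\<eta> e) < n" "snd (\<eta> e) < n"
      if "e \<in> {1..N}" "fst y \<in> J (\<eta> e)" for e and y :: "'a \<times> real"
      using that \<eta>in(1)[OF that(1)] by (auto simp: J_def crown_edges_def split: prod.splits)
    have YL: "Y \<inter> L e = J (\<eta> e) \<times> {0}" "Y \<inter> R e = J (\<eta> e) \<times> {1}" if e: "e \<in> {1..N}" for e
    proof -
      show "Y \<inter> L e = J (\<eta> e) \<times> {0}"
      proof (intro equalityI subsetI)
        fix y assume y: "y \<in> Y \<inter> L e"
        then have "y \<notin> (\<Union>e\<in>crown_tree n. J e \<times> {0..1})" by (intro notY[OF e]) (auto simp: L_def)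
        then have "snd y = 0 \<or> snd y = 1" using y by (auto simp: Yeq)
        then show "y \<in> J (\<eta> e) \<times> {0}" using y by (auto simp: L_def)
      next
        fix y assume y: "y \<in> J (\<eta> e) \<times> {0::real}"
        then have "y \<in> (\<Union>j<n. U j \<times> {0})" using Jm[OF e, of y] by (intro UN_I[of "snd (\<eta> e)"]) auto
        then show "y \<in> Y \<inter> L e" using y by (auto simp: Yeq L_def)
      qed
      show "Y \<inter> R e = J (\<eta> e) \<times> {1}"
      proof (intro equalityI subsetI)
        fix y assume y: "y \<in> Y \<inter> R e"
        then have "y \<notin> (\<Union>e\<in>crown_tree n. J e \<times> {0..1})" by (intro notY[OF e]) (auto simp: R_def)
        then have "snd y = 0 \<or> snd y = 1" using y by (auto simp: Yeq)
        then show "y \<in> J (\<eta> e) \<times> {1}" using y by (auto simp: R_def)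
      next
        fix y assume y: "y \<in> J (\<eta> e) \<times> {1::real}"
        then have "y \<in> (\<Union>i<n. W i \<times> {1})" using Jm[OF e, of y] by (intro UN_I[of "fst (\<eta> e)"]) auto
        then show "y \<in> Y \<inter> R e" using y by (auto simp: Yeq R_def)
      qed
    qed
    have "L e \<inter> R e = J (\<eta> e) \<times> {1/2}" for e by (auto simp: L_def R_def)
    moreover have "Y \<inter> L e \<inter> R e = {}" if "e \<in> {1..N}" for e
      unfolding YL(1)[OF that] by (auto simp: R_def)
    moreover have "(L e \<union> R e) \<inter> (L e' \<union> R e') = {}" if e: "e \<in> {1..N}" "e' \<in> {1..N}" "e \<noteq> e'" for e e'
    proof -
      have "\<eta> e \<noteq> \<eta> e'" using \<eta> e unfolding bij_betw_def inj_on_def by blast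
      then have "J (\<eta> e) \<inter> J (\<eta> e') = {}" using uJ \<eta>in e by blast
      then show ?thesis by (auto simp: L_def R_def)
    qed
    moreover have "AR (L e)" "AR (R e)" "closed (L e)" "closed (R e)" if "e \<in> {1..N}" for e
      using J[OF \<eta>in(1)[OF that]] by (auto simp: L_def R_def intro!: AR_Times AR01 closed_Times)
    ultimately show ?thesis unfolding loop_AR_cover_def
      using Y YL J(2)[OF \<eta>in(1)] by (simp add: AR_Times AR01)
  qed
  have "(\<Union>i<n. U' i) \<union> (\<Union>i<n. W' i) = Y \<union> (\<Union>e\<in>{1..N}. L e \<union> R e)"
  proof -
    have "(\<Union>i<n. U' i) \<union> (\<Union>i<n. W' i) =
       (\<Union>j<n. U j \<times> {0}) \<union> (\<Union>i<n. W i \<times> {1}) \<union> (\<Union>e\<in>crown_edges n. J e \<times> {0..1})"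
      unfolding U'_def W'_def crown_edges_def by auto
    also have "crown_edges n = crown_tree n \<union> \<eta> ` {1..N}"
      using \<eta> crown_tree_subset[OF n] unfolding bij_betw_def by auto
    also have "(\<Union>e\<in>crown_tree n \<union> \<eta> ` {1..N}. J e \<times> {0..1}) = (\<Union>e\<in>crown_tree n. J e \<times> {0..1}) \<union> (\<Union>e\<in>{1..N}. L e \<union> R e)"
    proof -
      have "L e \<union> R e = J (\<eta> e) \<times> {0..1}" for e by (auto simp: L_def R_def)
      then show ?thesis by auto
    qed
    finally show ?thesis by (simp add: Yeq Un_assoc)
  qed
  then have "(\<Union>i<n. U i) \<union> (\<Union>i<n. W i) homotopy_eqv Y \<union> (\<Union>e\<in>{1..N}. L e \<union> R e)"
    using bipartite_AR_covers_homotopy_eqv[OF cov cov'] by simp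
  moreover have "Y \<union> (\<Union>e\<in>{1..N}. L e \<union> R e) homotopy_eqv bouquet N"
    using loop_AR_covers_homotopy_eqv[OF loop bouquet_loop_AR_cover(1)] bouquet_loop_AR_cover(2)[of N]
    by (simp add: N_def)
  ultimately show ?thesis unfolding N_def[symmetric] by (rule homotopy_eqv_trans)
qed

section \<open>Paths in star-like trees\<close>

text \<open>Branch number and depth act as coordinates, replacing lists by arithmetic.
  \<open>parent_ex\<close> excludes gaps in the depths along a branch, and \<open>depth_2_ex\<close>
  records that branches have length at least 2.\<close>

locale star_tree =
  fixes E :: "'v::finite set set" and n :: nat and br dp :: "'v \<Rightarrow> nat" and c :: 'v
  assumes dp_eq_0: "dp v = 0 \<longleftrightarrow> v = c"
    and br_less: "v \<noteq> c \<Longrightarrow> br v < n"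
    and label_inj: "\<lbrakk>br v = br w; dp v = dp w; v \<noteq> c\<rbrakk> \<Longrightarrow> v = w"
    and parent_ex: "\<lbrakk>v \<noteq> c; dp v \<noteq> 1\<rbrakk> \<Longrightarrow> \<exists>w. w \<noteq> c \<and> br w = br v \<and> Suc (dp w) = dp v"
    and depth_2_ex: "i < n \<Longrightarrow> \<exists>w. br w = i \<and> dp w = 2"
    and edge_iff: "{v,w} \<in> E \<longleftrightarrow> (Suc (dp v) = dp w \<and> (v = c \<or> br v = br w)) \<or>
                                    (Suc (dp w) = dp v \<and> (w = c \<or> br v = br w))"
begin

text \<open>The order of the tree rooted at \<open>c\<close>. The value of \<open>br c\<close> is irrelevant.\<close>

definition anc :: "'v \<Rightarrow> 'v \<Rightarrow> bool" where
  "anc x v \<longleftrightarrow> x = c \<or> (v \<noteq> c \<and> br x = br v \<and> dp x \<le> dp v)"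

text \<open>A vertex is on a tree path iff it is an ancestor of exactly one end or is the lowest
  common ancestor of both. In a star-like tree the latter is \<open>c\<close> or one of the ends,
  whence the separate clauses.\<close>

definition path :: "'v \<Rightarrow> 'v \<Rightarrow> 'v set" where
  "path v w = {x. if x = c then v = c \<or> w = c \<or> br v \<noteq> br w else anc x v \<noteq> anc x w \<or> x = v \<or> x = w}"

lemma anc_refl [simp]: "anc v v" by (auto simp: anc_def)

lemma anc_trans: "anc x y \<Longrightarrow> anc y z \<Longrightarrow> anc x z"
  by (auto simp: anc_def)

lemma anc_antisym: "anc x y \<Longrightarrow> anc y x \<Longrightarrow> x = y"
  unfolding anc_def by (metis label_inj le_antisym)

lemma anc_linear: "anc x v \<Longrightarrow> anc y v \<Longrightarrow> anc x y \<or> anc y x"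
  by (auto simp: anc_def)

lemma path_commute: "path v w = path w v" by (auto simp: path_def)

lemma path_ends [simp]: "v \<in> path v w" "w \<in> path v w" by (auto simp: path_def)

lemma path_refl [simp]: "path v v = {v}" by (auto simp: path_def)

lemma c_in_path_iff: "c \<in> path v w \<longleftrightarrow> v = c \<or> w = c \<or> br v \<noteq> br w" by (simp add: path_def)

lemma in_path_iff: "x \<noteq> c \<Longrightarrow> x \<in> path v w \<longleftrightarrow> anc x v \<noteq> anc x w \<or> x = v \<or> x = w"
  by (simp add: path_def)

abbreviation step :: "'v set \<Rightarrow> 'v \<Rightarrow> 'v \<Rightarrow> bool" where
  "step S \<equiv> (\<lambda>a b. a \<in> S \<and> b \<in> S \<and> {a, b} \<in> E)"

lemma edge_cases:
  assumes "{u,w} \<in> E"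
  obtains "w \<noteq> c" "anc u w" "\<And>x. anc x w \<Longrightarrow> x = w \<or> anc x u"
    | "u \<noteq> c" "anc w u" "\<And>x. anc x u \<Longrightarrow> x = u \<or> anc x w"
proof -
  have down: "w \<noteq> c \<and> anc u w \<and> (\<forall>x. anc x w \<longrightarrow> x = w \<or> anc x u)"
    if "Suc (dp u) = dp w" "u = c \<or> br u = br w" for u w
  proof -
    have "w \<noteq> c" using that(1) dp_eq_0[of w] by auto
    moreover have "anc u w" using that calculation by (auto simp: anc_def)
    moreover have "x = w \<or> anc x u" if x: "anc x w" for x
    proof (cases "x = c \<or> x = w")
      case True
      then show ?thesis by (auto simp: anc_def)
    next
      case False
      then have "br x = br w" "dp x \<le> dp w" "dp x \<noteq> 0" using x dp_eq_0 by (auto simp: anc_def)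
      moreover have "dp x \<noteq> dp w" using label_inj[of x w] False calculation by auto
      ultimately have "dp x \<le> dp u" "u \<noteq> c" using \<open>Suc (dp u) = dp w\<close> dp_eq_0[of u] by auto
      then show ?thesis using \<open>br x = br w\<close> \<open>u = c \<or> br u = br w\<close> by (auto simp: anc_def)
    qed
    ultimately show ?thesis by blast
  qed
  from assms have "Suc (dp u) = dp w \<and> (u = c \<or> br u = br w) \<or> Suc (dp w) = dp u \<and> (w = c \<or> br w = br u)"
    unfolding edge_iff by auto
  then show ?thesis using down[of u w] down[of w u] that by blast
qed

text \<open>The ancestors of adjacent vertices differ only in the deeper of the two, so moving an
  end along an edge brings in no other vertex.\<close>

lemma path_snoc:
  assumes "{u,w} \<in> E"
  shows "path v w \<subseteq> insert w (path v u)"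
proof
  fix x assume x: "x \<in> path v w"
  have brs: "u = c \<or> w = c \<or> br u = br w" using assms dp_eq_0 unfolding edge_iff by auto
  show "x \<in> insert w (path v u)"
  proof (cases "x = c")
    case True
    show ?thesis
    proof (cases "c = w \<or> u = c")
      case True
      then show ?thesis using \<open>x = c\<close> by (auto simp: c_in_path_iff)
    next
      case False
      then show ?thesis using True x brs by (auto simp: c_in_path_iff)
    qed
  next
    case False
    then have x': "anc x v \<noteq> anc x w \<or> x = v \<or> x = w" using x by (simp add: in_path_iff)
    show ?thesis
    proof (rule ccontr)
      assume n: "x \<notin> insert w (path v u)"
      then have *: "anc x v = anc x u" "x \<noteq> v" "x \<noteq> u" "x \<noteq> w" using False by (auto simp: in_path_iff)
      from assms have "anc x u = anc x w"
        by (cases rule: edge_cases) (use * anc_trans in blast)+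
      then show False using * x' by simp
    qed
  qed
qed

lemma parent:
  assumes "v \<noteq> c"
  obtains u where "{v,u} \<in> E" "Suc (dp u) = dp v" "anc u v"
proof (cases "dp v = 1")
  case True
  then have "{v,c} \<in> E" "Suc (dp c) = dp v" "anc c v" using dp_eq_0[of c] by (auto simp: edge_iff anc_def)
  then show ?thesis using that by blast
next
  case False
  then obtain w where "w \<noteq> c" "br w = br v" "Suc (dp w) = dp v" using parent_ex assms by blast
  then show ?thesis using that[of w] assms by (auto simp: edge_iff anc_def)
qed

lemma reach_sym: "(step S)\<^sup>*\<^sup>* v w \<Longrightarrow> (step S)\<^sup>*\<^sup>* w v"
proof (induction rule: rtranclp_induct)
  case (step y z)
  then have "step S z y" by (simp add: insert_commute)
  then show ?case using step.IH by (rule converse_rtranclp_into_rtranclp[of "step S"])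
qed simp

text \<open>The deeper end moves to its parent: the path shrinks and the sum of the depths drops.
  \<open>main\<close> treats one order of depths; the other follows by symmetry.\<close>

lemma path_subset_imp_reach: "path v w \<subseteq> S \<Longrightarrow> (step S)\<^sup>*\<^sup>* v w"
proof (induction "dp v + dp w" arbitrary: v w rule: less_induct)
  case less
  have main: "(step S)\<^sup>*\<^sup>* v w"
    if vw: "path v w \<subseteq> S" "v \<noteq> w" "dp w \<le> dp v" and
      IH: "\<And>u. dp u < dp v \<Longrightarrow> path u w \<subseteq> S \<Longrightarrow> (step S)\<^sup>*\<^sup>* u w" for v w
  proof -
    have "v \<noteq> c" using vw dp_eq_0[of v] dp_eq_0[of w] by auto
    then obtain u where u: "{v,u} \<in> E" "Suc (dp u) = dp v" "anc u v" using parent by blast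
    have "\<not> anc v w"
    proof
      assume "anc v w"
      then have "br v = br w" "dp v \<le> dp w" using \<open>v \<noteq> c\<close> by (auto simp: anc_def)
      then show False using label_inj[of v w] vw \<open>v \<noteq> c\<close> by auto
    qed
    have "path u w \<subseteq> path v w"
    proof
      fix x assume x: "x \<in> path u w"
      show "x \<in> path v w"
      proof (cases "x = c")
        case True
        show ?thesis
        proof (cases "w = c \<or> br v \<noteq> br w")
          case False
          then have "u \<noteq> c \<longrightarrow> br u = br v" using u(3) by (auto simp: anc_def)
          then have "u = c" using x True False by (auto simp: c_in_path_iff)
          then have "dp v = 1" using u dp_eq_0[of c] by simp
          then have "dp w = 1" using vw dp_eq_0[of w] False by simp
          then have "v = w" using label_inj[of v w] False \<open>v \<noteq> c\<close> \<open>dp v = 1\<close> by auto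
          then show ?thesis using vw by simp
        qed (use True in \<open>auto simp: c_in_path_iff\<close>)
      next
        case False
        then have x': "anc x u \<noteq> anc x w \<or> x = u \<or> x = w" using x by (simp add: in_path_iff)
        have "u \<noteq> v" using u by auto
        show ?thesis
        proof (cases "x = w")
          case False
          have av: "anc x v" if "anc x u" using that u(3) anc_trans by blast
          have au: "anc x u" if "anc x v" "x \<noteq> v"
          proof -
            from u(1) have "anc x u"
            proof (cases rule: edge_cases)
              case 1
              then show ?thesis using u(3) anc_antisym \<open>u \<noteq> v\<close> by blast
            next
              case 2
              then show ?thesis using that by blast
            qed
            then show ?thesis .
          qed
          have "x = u \<Longrightarrow> anc x w \<Longrightarrow> x \<in> path v w"
          proof -
            assume "x = u" "anc x w"
            then have uc: "u \<noteq> c" using \<open>x \<noteq> c\<close> by simp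
            have "br u = br v" "br u = br w" "dp u \<le> dp w" "w \<noteq> c"
              using u(3) uc \<open>anc x w\<close> \<open>x = u\<close> by (auto simp: anc_def)
            moreover have "dp w \<noteq> dp u" using label_inj[of w u] calculation \<open>x \<noteq> w\<close> \<open>x = u\<close> by auto
            ultimately have "dp w = dp v" using u(2) vw(3) by simp
            then show ?thesis using label_inj[of v w] \<open>br u = br v\<close> \<open>br u = br w\<close> \<open>v \<noteq> c\<close> vw by auto
          qed
          then show ?thesis using x' False av au \<open>x \<noteq> c\<close> \<open>\<not> anc v w\<close>
            by (metis in_path_iff anc_refl)
        qed simp
      qed
    qed
    then have "(step S)\<^sup>*\<^sup>* u w" using IH[of u] u vw by simp
    moreover have "step S v u" using u vw \<open>path u w \<subseteq> path v w\<close> path_ends by blast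
    ultimately show ?thesis using converse_rtranclp_into_rtranclp[of "step S" v u w] by blast
  qed
  show ?case
  proof (cases "v = w")
    case False
    show ?thesis
    proof (cases "dp w \<le> dp v")
      case True
      show ?thesis by (rule main[OF less.prems False True], rule less.hyps) auto
    next
      case wv: False
      have "(step S)\<^sup>*\<^sup>* w v"
      proof (rule main)
        show "path w v \<subseteq> S" using less.prems path_commute by simp
        fix u assume "dp u < dp w" "path u v \<subseteq> S"
        then have "(step S)\<^sup>*\<^sup>* v u" by (intro less.hyps) (auto simp: path_commute)
        then show "(step S)\<^sup>*\<^sup>* u v" by (rule reach_sym)
      qed (use False wv in auto)
      then show ?thesis by (rule reach_sym)
    qed
  qed simp
qed

text \<open>This turns components of induced subgraphs, and with them \<open>comp_count\<close>,
  into inclusions of paths.\<close>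

lemma reach_iff_path_subset:
  assumes "v \<in> S"
  shows "(step S)\<^sup>*\<^sup>* v w \<longleftrightarrow> path v w \<subseteq> S"
proof
  show "(step S)\<^sup>*\<^sup>* v w \<Longrightarrow> path v w \<subseteq> S"
  proof (induction rule: rtranclp_induct)
    case (step u w)
    then show ?case using path_snoc[of u w v] by auto
  qed (use assms in simp)
qed (rule path_subset_imp_reach)

text \<open>Transitivity of reachability inside the union of the two paths replaces a case analysis
  on positions.\<close>

lemma path_triangle: "path v w \<subseteq> path v u \<union> path u w"
proof -
  let ?S = "path v u \<union> path u w"
  have "(step ?S)\<^sup>*\<^sup>* v u" "(step ?S)\<^sup>*\<^sup>* u w" by (rule path_subset_imp_reach; simp)+
  then have "(step ?S)\<^sup>*\<^sup>* v w" by simp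
  then show ?thesis using reach_iff_path_subset[of v ?S w] path_ends by blast
qed

end

lemma star_like_tree_imp_star_tree:
  fixes E :: "'v::finite set set"
  assumes "star_like_tree E n"
  obtains br dp c where "star_tree E n br dp c"
proof -
  obtain c ps where len: "length ps = n"
    and ps: "\<forall>p\<in>set ps. distinct p \<and> length p \<ge> 3 \<and> hd p = c"
    and disj: "\<forall>i<n. \<forall>j<n. i \<noteq> j \<longrightarrow> set (ps!i) \<inter> set (ps!j) = {c}"
    and un: "(\<Union>p\<in>set ps. set p) = UNIV"
    and E: "E = (\<Union>p\<in>set ps. {{p!k, p!(k+1)} | k. k + 1 < length p})"
    using assms unfolding star_like_tree_def by blast
  have P: "distinct (ps!i)" "length (ps!i) \<ge> 3" "ps!i!0 = c" if "i < n" for i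
  proof -
    have *: "ps!i \<in> set ps" using that len by simp
    then show "distinct (ps!i)" "length (ps!i) \<ge> 3" using ps by auto
    then have "ps!i \<noteq> []" by auto
    then show "ps!i!0 = c" using ps * hd_conv_nth[of "ps!i"] by auto
  qed
  have "\<exists>ik. fst ik < n \<and> snd ik < length (ps!fst ik) \<and> ps!fst ik!snd ik = v" for v
  proof -
    have "v \<in> (\<Union>p\<in>set ps. set p)" using un by simp
    then obtain p where "p \<in> set ps" "v \<in> set p" by blast
    then obtain i where "i < n" "v \<in> set (ps!i)" using len in_set_conv_nth[of p ps] by blast
    then obtain k where "k < length (ps!i)" "ps!i!k = v" by (auto simp: in_set_conv_nth)
    then show ?thesis using \<open>i < n\<close> by (intro exI[of _ "(i,k)"]) simp
  qed
  \<comment> \<open>A label is a branch and a position in it. The centre lies on all branches, so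
    its branch is an arbitrary choice, but its position is always 0.\<close>
  then obtain lab where lab: "\<And>v. fst (lab v) < n \<and> snd (lab v) < length (ps!fst (lab v)) \<and> ps!fst (lab v)!snd (lab v) = v"
    by metis
  define br where "br v = fst (lab v)" for v
  define dp where "dp v = snd (lab v)" for v
  have L: "br v < n" "dp v < length (ps!br v)" "ps!br v!dp v = v" for v using lab by (auto simp: br_def dp_def)
  have notc: "ps!i!k \<noteq> c" if "i < n" "k < length (ps!i)" "0 < k" for i k
  proof -
    have "ps!i!k \<noteq> ps!i!0" using P(1)[OF that(1)] that nth_eq_iff_index_eq[of "ps!i" k 0] by fastforce
    then show ?thesis using P(3)[OF that(1)] by simp
  qed
  have uniq: "br (ps!i!k) = i" "dp (ps!i!k) = k" if "i < n" "k < length (ps!i)" "0 < k" for i k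
  proof -
    let ?v = "ps!i!k"
    show b: "br ?v = i"
    proof (rule ccontr)
      assume "br ?v \<noteq> i"
      then have "set (ps!br ?v) \<inter> set (ps!i) = {c}" using disj L(1) that(1) by blast
      moreover have "?v \<in> set (ps!br ?v)" using L[of ?v] nth_mem by metis
      moreover have "?v \<in> set (ps!i)" using that nth_mem by blast
      ultimately show False using notc[OF that] by blast
    qed
    show "dp ?v = k" using L[of ?v] b that P(1)[OF that(1)] nth_eq_iff_index_eq[of "ps!i" "dp ?v" k] by simp
  qed
  have dpc: "dp c = 0" using L[of c] notc[of "br c" "dp c"] by auto
  have dp0: "dp v = 0 \<longleftrightarrow> v = c" for v using L[of v] P(3)[of "br v"] dpc by metis
  have edge: "{v,w} \<in> E \<longleftrightarrow> (Suc (dp v) = dp w \<and> (v = c \<or> br v = br w)) \<or> (Suc (dp w) = dp v \<and> (w = c \<or> br v = br w))" for v w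
  proof
    have up: "Suc (dp (ps!i!k)) = dp (ps!i!Suc k) \<and> (ps!i!k = c \<or> br (ps!i!k) = br (ps!i!Suc k))"
      if "i < n" "Suc k < length (ps!i)" for i k
      using uniq[of i "Suc k"] uniq[of i k] P(3)[of i] dpc that by (cases k) auto
    assume "{v,w} \<in> E"
    then obtain p k where "p \<in> set ps" "Suc k < length p" "{v,w} = {p!k, p!Suc k}" unfolding E by auto
    then obtain i where "i < n" "Suc k < length (ps!i)" "{v,w} = {ps!i!k, ps!i!Suc k}"
      using len in_set_conv_nth[of p ps] by metis
    then show "(Suc (dp v) = dp w \<and> (v = c \<or> br v = br w)) \<or> (Suc (dp w) = dp v \<and> (w = c \<or> br v = br w))"
      using up[of i k] by (auto simp: doubleton_eq_iff)
  next
    have down: "{v,w} \<in> E" if "Suc (dp v) = dp w" "v = c \<or> br v = br w" for v w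
    proof -
      have "ps!br w!dp v = v" using that L[of v] dpc P(3)[of "br w"] L(1)[of w] by auto
      moreover have "ps!br w!(dp v + 1) = w" "dp v + 1 < length (ps!br w)" using that L[of w] by auto
      moreover have "ps!br w \<in> set ps" using L(1)[of w] len by simp
      ultimately show ?thesis unfolding E
        by (intro UN_I[of "ps!br w"] CollectI exI[of _ "dp v"]) simp_all
    qed
    assume "(Suc (dp v) = dp w \<and> (v = c \<or> br v = br w)) \<or> (Suc (dp w) = dp v \<and> (w = c \<or> br v = br w))"
    then show "{v,w} \<in> E" using down[of v w] down[of w v] by (auto simp: insert_commute)
  qed
  have "star_tree E n br dp c"
  proof
    show "dp v = 0 \<longleftrightarrow> v = c" for v by (rule dp0)
    show "br v < n" for v by (rule L)
    show "v = w" if "br v = br w" "dp v = dp w" for v w using L(3) that by metis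
    show "\<exists>w. w \<noteq> c \<and> br w = br v \<and> Suc (dp w) = dp v" if "v \<noteq> c" "dp v \<noteq> 1" for v
    proof -
      have "dp v \<noteq> 0" using that dp0 by simp
      then have k: "0 < dp v - 1" "dp v - 1 < length (ps!br v)" using that L(2)[of v] by auto
      then show ?thesis using notc[OF L(1) k(2,1)] uniq[OF L(1) k(2,1)] by (intro exI[of _ "ps!br v!(dp v - 1)"]) auto
    qed
    show "\<exists>w. br w = i \<and> dp w = 2" if "i < n" for i
      using uniq[OF that, of 2] P(2)[OF that] by (intro exI[of _ "ps!i!2"]) auto
    show "{v,w} \<in> E \<longleftrightarrow> (Suc (dp v) = dp w \<and> (v = c \<or> br v = br w)) \<or> (Suc (dp w) = dp v \<and> (w = c \<or> br v = br w))" for v w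
      by (rule edge)
  qed
  then show ?thesis using that by blast
qed

section \<open>Vectors with the prescribed diagram\<close>

text \<open>Finitely many values occur, so a strict sublevel set is an ordinary one at a smaller
  level. The bound \<open>e\<close> lets the new level stay on the required side of 0, 1 or
  4.\<close>

lemma sub_lt_eq_sub_le:
  fixes z :: "real^'v::finite"
  assumes "e < b"
  obtains b' where "e \<le> b'" "b' < b" "sub_lt z b = sub_le z b'"
proof -
  \<comment> \<open>Inserting \<open>e\<close> provides a maximum even for an empty sublevel set and
    forces it to be at least \<open>e\<close>.\<close>
  define X where "X = insert e ((\<lambda>v. z $ v) ` sub_lt z b)"
  have fin: "finite X" "X \<noteq> {}" by (auto simp: X_def)
  show ?thesis
  proof (rule that[of "Max X"])
    show "e \<le> Max X" using fin by (auto simp: X_def)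
    show "Max X < b" using Max_in[OF fin] assms by (auto simp: X_def sub_lt_def)
    show "sub_lt z b = sub_le z (Max X)"
    proof (intro equalityI subsetI)
      fix v assume "v \<in> sub_lt z b"
      then show "v \<in> sub_le z (Max X)" using fin by (auto simp: X_def sub_le_def)
    next
      fix v assume "v \<in> sub_le z (Max X)"
      then show "v \<in> sub_lt z b" using \<open>Max X < b\<close> by (auto simp: sub_le_def sub_lt_def)
    qed
  qed
qed

context star_tree begin

lemma comp_count_alt:
  assumes "A \<subseteq> S"
  shows "comp_count E A S = card ((\<lambda>v. {w. path v w \<subseteq> S}) ` A)"
proof -
  have "{w \<in> S. (step S)\<^sup>*\<^sup>* v w} = {w. path v w \<subseteq> S}" if "v \<in> A" for v
    using reach_iff_path_subset[of v S] that assms path_ends by blast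
  then have "(\<lambda>v. {w \<in> S. (step S)\<^sup>*\<^sup>* v w}) ` A = (\<lambda>v. {w. path v w \<subseteq> S}) ` A"
    by (intro image_cong) auto
  then show ?thesis unfolding comp_count_def by simp
qed

lemma path_class_eq: 
  assumes "path v w \<subseteq> S"
  shows "{x. path v x \<subseteq> S} = {x. path w x \<subseteq> S}"
proof -
  have "path v x \<subseteq> path v w \<union> path w x" "path w x \<subseteq> path v w \<union> path v x" for x
    using path_triangle[of v x w] path_triangle[of w x v] path_commute[of v w] by auto
  then show ?thesis using assms by blast
qed

lemma path_class_eq_iff:
  assumes "w \<in> S"
  shows "{x. path v x \<subseteq> S} = {x. path w x \<subseteq> S} \<longleftrightarrow> path v w \<subseteq> S"
proof
  assume "{x. path v x \<subseteq> S} = {x. path w x \<subseteq> S}"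
  moreover have "w \<in> {x. path w x \<subseteq> S}" using assms by simp
  ultimately show "path v w \<subseteq> S" by blast
qed (rule path_class_eq)

lemma comp_count_empty [simp]: "comp_count E {} S = 0"
  by (simp add: comp_count_def)

lemma comp_count_eq_1:
  assumes "A \<subseteq> S" "a \<in> A" "\<And>v. v \<in> A \<Longrightarrow> path v a \<subseteq> S"
  shows "comp_count E A S = 1"
proof -
  have "(\<lambda>v. {w. path v w \<subseteq> S}) ` A = (\<lambda>v. {w. path a w \<subseteq> S}) ` A"
    by (rule image_cong[OF refl]) (rule path_class_eq[OF assms(3)])
  also have "\<dots> = {{w. path a w \<subseteq> S}}" using assms(2) by blast
  finally have "(\<lambda>v. {w. path v w \<subseteq> S}) ` A = {{w. path a w \<subseteq> S}}" .
  then show ?thesis using comp_count_alt[OF assms(1)] by simp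
qed

lemma comp_count_eq_2:
  assumes "A \<subseteq> S" "a \<in> A" "b \<in> A" "\<not> path a b \<subseteq> S" "\<And>v. v \<in> A \<Longrightarrow> path v a \<subseteq> S \<or> path v b \<subseteq> S"
  shows "comp_count E A S = 2"
proof -
  have "(\<lambda>v. {w. path v w \<subseteq> S}) ` A = {{w. path a w \<subseteq> S}, {w. path b w \<subseteq> S}}"
  proof (intro equalityI image_subsetI)
    fix v assume "v \<in> A"
    then show "{w. path v w \<subseteq> S} \<in> {{w. path a w \<subseteq> S}, {w. path b w \<subseteq> S}}"
      using assms(5)[of v] path_class_eq[of v a S] path_class_eq[of v b S] by blast
  qed (use assms(2,3) in simp)
  moreover have "{w. path a w \<subseteq> S} \<noteq> {w. path b w \<subseteq> S}"
    using path_class_eq_iff[of b S a] assms by blast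
  ultimately show ?thesis using comp_count_alt[OF assms(1)] by simp
qed

lemma comp_count_1D:
  assumes "comp_count E A S = 1" "A \<subseteq> S" "v \<in> A" "w \<in> A"
  shows "path v w \<subseteq> S"
proof -
  obtain X where "(\<lambda>v. {w. path v w \<subseteq> S}) ` A = {X}"
    using assms comp_count_alt card_1_singletonE by metis
  then have "{x. path v x \<subseteq> S} = {x. path w x \<subseteq> S}" using assms(3,4) by (metis imageI singletonD)
  then show ?thesis using path_class_eq_iff[of w S v] assms by blast
qed

lemma comp_count_2D:
  assumes "comp_count E A S = 2" "A \<subseteq> S" "a \<in> A" "b \<in> A" "v \<in> A" "\<not> path a b \<subseteq> S"
  shows "path v a \<subseteq> S \<or> path v b \<subseteq> S"
proof (rule ccontr)
  assume *: "\<not> ?thesis"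
  let ?f = "\<lambda>v. {w. path v w \<subseteq> S}"
  have ne: "?f a \<noteq> ?f b" "?f v \<noteq> ?f a" "?f v \<noteq> ?f b"
    using path_class_eq_iff[of b S a] path_class_eq_iff[of a S v] path_class_eq_iff[of b S v] assms * by blast+
  have "card {?f a, ?f b, ?f v} \<le> card (?f ` A)"
    using assms by (intro card_mono) auto
  moreover have "card {?f a, ?f b, ?f v} = 3" using ne by (subst card_insert_disjoint; auto)+
  ultimately show False using comp_count_alt[OF assms(2)] assms(1) by simp
qed

section \<open>From the persistence diagram to the rank function\<close>

text \<open>The rank function of the diagram: a bar [b, d) counts when b \<le> r and s < d.\<close>

definition rank_cond :: "real^'v \<Rightarrow> bool" where
  "rank_cond z \<longleftrightarrow> (\<forall>r s. r \<le> s \<longrightarrow>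
     int (comp_count E (sub_le z r) (sub_le z s)) = of_bool (0 \<le> r) + of_bool (1 \<le> r \<and> s < 4))"

lemma count_diagram:
  "count {#(0::real, \<infinity>::ereal), (1, 4)#} (b, \<infinity>) = of_bool (b = 0)"
  "count {#(0::real, \<infinity>::ereal), (1, 4)#} (b, ereal d) = of_bool (b = 1 \<and> d = 4)"
  "count {#(0::real, \<infinity>::ereal), (1, 4)#} (b, - \<infinity>) = 0"
  by auto

lemma PH0_eq_iff:
  "PH0_eq E z {#(0, \<infinity>), (1, 4)#} \<longleftrightarrow>
     (\<forall>b. int (comp_count E (sub_le z b) UNIV) - int (comp_count E (sub_lt z b) UNIV) = of_bool (b = 0)) \<and>
     (\<forall>b d. b < d \<longrightarrow>
        int (comp_count E (sub_le z b) (sub_lt z d)) - int (comp_count E (sub_lt z b) (sub_lt z d))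
      - int (comp_count E (sub_le z b) (sub_le z d)) + int (comp_count E (sub_lt z b) (sub_le z d)) =
        of_bool (b = 1 \<and> d = 4))"
  (is "_ \<longleftrightarrow> ?A \<and> ?B")
proof -
  have "PH0_eq E z {#(0, \<infinity>), (1, 4)#} \<longleftrightarrow>
    (\<forall>b. ph0 E z (b, \<infinity>) = of_bool (b = 0)) \<and> (\<forall>b d. ph0 E z (b, ereal d) = of_bool (b = 1 \<and> d = 4))"
  proof -
    have "(\<forall>p. ph0 E z p = int (count {#(0, \<infinity>), (1, 4)#} p)) \<longleftrightarrow>
       (\<forall>b. \<forall>x. ph0 E z (b,x) = int (count {#(0, \<infinity>), (1, 4)#} (b,x)))" by auto
    also have "\<dots> \<longleftrightarrow> (\<forall>b. ph0 E z (b, \<infinity>) = of_bool (b = 0)) \<and>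
        (\<forall>b d. ph0 E z (b, ereal d) = of_bool (b = 1 \<and> d = 4))"
    proof -
      have all: "(\<forall>x::ereal. P x) \<longleftrightarrow> (\<forall>d. P (ereal d)) \<and> P \<infinity> \<and> P (- \<infinity>)" for P
        by (metis ereal_cases)
      have "ph0 E z (b, - \<infinity>) = 0" for b by (simp add: ph0_def flip: MInfty_eq_minfinity)
      then show ?thesis unfolding all count_diagram by auto
    qed
    finally show ?thesis unfolding PH0_eq_def .
  qed
  also have "(\<forall>b. ph0 E z (b, \<infinity>) = of_bool (b = 0)) \<longleftrightarrow> ?A"
    by (simp add: ph0_def flip: infinity_ereal_def)
  also have "(\<forall>b d. ph0 E z (b, ereal d) = of_bool (b = 1 \<and> d = 4)) \<longleftrightarrow> ?B"
    by (auto simp: ph0_def)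
  finally show ?thesis .
qed

text \<open>Multiplicities are second differences of ranks. Conversely ranks are recovered by
  summation, over deaths and then over births; induction on the cardinality of a sublevel set or of
  its complement runs through the finitely many critical values.\<close>

lemma PH0_eq_iff_rank_cond: "PH0_eq E z {#(0, \<infinity>), (1, 4)#} \<longleftrightarrow> rank_cond z"
proof
  assume "PH0_eq E z {#(0, \<infinity>), (1, 4)#}"
  then have A: "\<And>b. int (comp_count E (sub_le z b) UNIV) - int (comp_count E (sub_lt z b) UNIV) = of_bool (b = 0)"
    and B: "\<And>b d. b < d \<Longrightarrow>
        int (comp_count E (sub_le z b) (sub_lt z d)) - int (comp_count E (sub_lt z b) (sub_lt z d))
      - int (comp_count E (sub_le z b) (sub_le z d)) + int (comp_count E (sub_lt z b) (sub_le z d)) =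
        of_bool (b = 1 \<and> d = 4)"
    unfolding PH0_eq_iff by auto
  have val: "\<exists>v. z $ v = r" if "sub_le z r \<noteq> sub_lt z r" for r
    using that by (force simp: sub_le_def sub_lt_def)
  \<comment> \<open>A nonzero multiplicity means that a sublevel set changes at that level, so the
    value is attained.\<close>
  have v0: "\<exists>v. z $ v = 0" using val[of 0] A[of 0] by (cases "sub_le z 0 = sub_lt z 0") auto
  have v1: "\<exists>v. z $ v = 1" using val[of 1] B[of 1 4] by (cases "sub_le z 1 = sub_lt z 1") auto
  have v4: "\<exists>v. z $ v = 4" using val[of 4] B[of 1 4] by (cases "sub_le z 4 = sub_lt z 4") auto
  \<comment> \<open>The jump of the rank at birth \<open>b\<close>. It is computed from large
    \<open>s\<close> downwards, starting where the sublevel set is everything and the formula for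
    infinite death applies.\<close>
  have delta: "int (comp_count E (sub_le z b) (sub_le z s)) - int (comp_count E (sub_lt z b) (sub_le z s))
      = of_bool (b = 0) + of_bool (b = 1 \<and> s < 4)" if "b \<le> s" for b s
    using that
  proof (induction "card (- sub_le z s)" arbitrary: s rule: less_induct)
    case less
    show ?case
    proof (cases "sub_le z s = UNIV")
      case True
      then have "4 \<le> s" using v4 unfolding sub_le_def by (metis UNIV_I mem_Collect_eq)
      then show ?thesis using A[of b] True by simp
    next
      case False
      define X where "X = (\<lambda>v. z $ v) ` (- sub_le z s)"
      define d where "d = Min X"
      have X: "finite X" "X \<noteq> {}" using False by (auto simp: X_def)
      have dX: "d \<in> X" using Min_in[OF X] by (simp add: d_def)
      have dmin: "d \<le> z $ v" if "s < z $ v" for v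
        using X that by (auto simp: d_def X_def sub_le_def intro!: Min_le)
      have sd: "s < d" using dX by (auto simp: X_def sub_le_def)
      have "z $ v < d \<longleftrightarrow> z $ v \<le> s" for v using dmin[of v] sd by (cases "s < z $ v") auto
      then have eq: "sub_lt z d = sub_le z s" by (simp add: sub_lt_def sub_le_def)
      have "- sub_le z d \<subset> - sub_le z s" using dX sd by (auto simp: X_def sub_le_def)
      then have "card (- sub_le z d) < card (- sub_le z s)" by (intro psubset_card_mono) auto
      then have "int (comp_count E (sub_le z b) (sub_le z d)) - int (comp_count E (sub_lt z b) (sub_le z d))
         = of_bool (b = 0) + of_bool (b = 1 \<and> d < 4)" using less.hyps[of d] less.prems sd by simp
      \<comment> \<open>No value lies strictly between \<open>s\<close> and \<open>d\<close>, and 4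
        is a value.\<close>
      moreover have "s < 4 \<longleftrightarrow> d \<le> 4" using v4 dmin sd by (metis order_less_le_trans)
      ultimately show ?thesis using B[of b d] less.prems sd unfolding eq by (auto simp: of_bool_def split: if_splits)
    qed
  qed
  have "int (comp_count E (sub_le z r) (sub_le z s)) = of_bool (0 \<le> r) + of_bool (1 \<le> r \<and> s < 4)"
    if "r \<le> s" for r s
    using that
  proof (induction "card (sub_le z r)" arbitrary: r rule: less_induct)
    case less
    show ?case
    proof (cases "sub_le z r = {}")
      case True
      then have "r < 0" using v0 unfolding sub_le_def by (metis empty_Collect_eq leI)
      then show ?thesis using True by simp
    next
      case False
      define X where "X = (\<lambda>v. z $ v) ` sub_le z r"
      define b where "b = Max X"
      have X: "finite X" "X \<noteq> {}" using False by (auto simp: X_def)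
      have bX: "b \<in> X" using Max_in[OF X] by (simp add: b_def)
      have bmax: "z $ v \<le> b" if "z $ v \<le> r" for v
        using X that by (auto simp: b_def X_def sub_le_def intro!: Max_ge)
      have br: "b \<le> r" using bX by (auto simp: X_def sub_le_def)
      have "z $ v \<le> r \<longleftrightarrow> z $ v \<le> b" for v using bmax[of v] br by (cases "z $ v \<le> r") auto
      then have eq: "sub_le z r = sub_le z b" by (simp add: sub_le_def)
      have r01: "0 \<le> r \<longleftrightarrow> 0 \<le> b" "1 \<le> r \<longleftrightarrow> 1 \<le> b" using v0 v1 bmax br order_trans by metis+
      \<comment> \<open>With \<open>e \<le> r'\<close> and \<open>r' < b\<close>, the passage from
        \<open>b\<close> to \<open>r'\<close> crosses no critical birth 0 or 1 other than
        \<open>b\<close> itself.\<close>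
      define e where "e = (if 1 < b then 1 else if 0 < b then 0 else b - 1)"
      have "e < b" by (auto simp: e_def)
      then obtain r' where r': "e \<le> r'" "r' < b" "sub_lt z b = sub_le z r'" using sub_lt_eq_sub_le by blast
      have "sub_le z r' \<subset> sub_le z r" using bX br r'(2) by (force simp: X_def sub_le_def)
      then have "card (sub_le z r') < card (sub_le z r)" by (intro psubset_card_mono) auto
      then have IH: "int (comp_count E (sub_le z r') (sub_le z s)) = of_bool (0 \<le> r') + of_bool (1 \<le> r' \<and> s < 4)"
        using less.hyps[of r'] less.prems br r' by simp
      have D: "int (comp_count E (sub_le z b) (sub_le z s)) = int (comp_count E (sub_le z r') (sub_le z s))
         + of_bool (b = 0) + of_bool (b = 1 \<and> s < 4)"
        using delta[of b s] less.prems br r' by simp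
      show ?thesis unfolding eq D IH r01 using r'(1,2) by (auto simp: e_def of_bool_def split: if_splits)
    qed
  qed
  then show "rank_cond z" unfolding rank_cond_def by blast
next
  assume R: "rank_cond z"
  have F: "int (comp_count E (sub_le z r) (sub_le z s)) = of_bool (0 \<le> r) + of_bool (1 \<le> r \<and> s < 4)"
    if "r \<le> s" for r s using R that unfolding rank_cond_def by blast
  show "PH0_eq E z {#(0, \<infinity>), (1, 4)#}"
    unfolding PH0_eq_iff
  proof (intro conjI allI impI)
    fix b
    define s where "s = Max (insert (max b 4) (range (\<lambda>v. z $ v)))"
    have le_s: "x \<le> s" if "x \<in> insert (max b 4) (range (\<lambda>v. z $ v))" for x
      unfolding s_def using that by (intro Max_ge) auto
    have s: "b \<le> s" "4 \<le> s" "\<And>v. z $ v \<le> s" using le_s[of "max b 4"] le_s by auto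
    have U: "UNIV = sub_le z s" using s(3) by (auto simp: sub_le_def)
    define e where "e = (if 0 < b then 0 else b - 1)"
    have "e < b" by (auto simp: e_def)
    then obtain b' where b': "e \<le> b'" "b' < b" "sub_lt z b = sub_le z b'" using sub_lt_eq_sub_le by blast
    show "int (comp_count E (sub_le z b) UNIV) - int (comp_count E (sub_lt z b) UNIV) = of_bool (b = 0)"
      unfolding U b'(3) using F[of b s] F[of b' s] s b'(1,2) by (auto simp: e_def split: if_splits)
  next
    fix b d :: real assume bd: "b < d"
    define e where "e = (if 1 < b then 1 else if 0 < b then 0 else b - 1)"
    have "e < b" by (auto simp: e_def)
    then obtain b' where b': "e \<le> b'" "b' < b" "sub_lt z b = sub_le z b'" using sub_lt_eq_sub_le by blast
    \<comment> \<open>The bound ensures \<open>b \<le> d'\<close>, and that \<open>d'\<close> drops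
      below 4 only when \<open>d \<le> 4\<close>.\<close>
    define g where "g = (if 4 < d then max 4 b else b)"
    have "g < d" using bd by (auto simp: g_def)
    then obtain d' where d': "g \<le> d'" "d' < d" "sub_lt z d = sub_le z d'" using sub_lt_eq_sub_le by blast
    have "b \<le> d'" using d' by (auto simp: g_def split: if_splits)
    have d4: "d' < 4 \<longleftrightarrow> d \<le> 4" using d'(1,2) by (auto simp: g_def split: if_splits)
    have b0: "0 \<le> b' \<longleftrightarrow> 0 < b" "1 \<le> b' \<longleftrightarrow> 1 < b" using b'(1,2) by (auto simp: e_def split: if_splits)
    show "int (comp_count E (sub_le z b) (sub_lt z d)) - int (comp_count E (sub_lt z b) (sub_lt z d))
      - int (comp_count E (sub_le z b) (sub_le z d)) + int (comp_count E (sub_lt z b) (sub_le z d)) =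
        of_bool (b = 1 \<and> d = 4)"
      unfolding b'(3) d'(3) using F[of b d'] F[of b' d'] F[of b d] F[of b' d] \<open>b \<le> d'\<close> b'(2) bd d4 b0
      by (auto simp: of_bool_def split: if_splits)
  qed
qed

section \<open>Description by two wells\<close>

definition low :: "real^'v \<Rightarrow> 'v \<Rightarrow> 'v \<Rightarrow> bool" where
  "low z v w \<longleftrightarrow> (\<forall>x\<in>path v w. z $ x \<le> z $ v)"

lemma low_iff: "low z v w \<longleftrightarrow> path v w \<subseteq> sub_le z (z $ v)"
  by (auto simp: low_def sub_le_def)

text \<open>The second part says that no third component is ever born, the first that the two wells
  are joined by level 4.\<close>

definition two_wells :: "real^'v \<Rightarrow> 'v \<Rightarrow> 'v \<Rightarrow> bool" where
  "two_wells z a b \<longleftrightarrow> (\<forall>x\<in>path a b. z $ x \<le> 4) \<and> (\<forall>v. low z v a \<or> low z v b)"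

text \<open>The shallow well is a vertex of value at most 1 that stays separated from the deep one
  below level 4; such a vertex exists because the rank is 2 just below 4.\<close>

lemma rank_cond_iff_wells:
  "rank_cond z \<longleftrightarrow> (\<exists>a b. z $ a = 0 \<and> z $ b = 1 \<and> (\<exists>p\<in>path a b. z $ p = 4) \<and> two_wells z a b)"
proof
  assume R: "rank_cond z"
  have F: "comp_count E (sub_le z r) (sub_le z s) = of_bool (0 \<le> r) + of_bool (1 \<le> r \<and> s < 4)"
    if "r \<le> s" for r s
  proof -
    have "int (comp_count E (sub_le z r) (sub_le z s)) = of_bool (0 \<le> r) + of_bool (1 \<le> r \<and> s < 4)"
      using R that unfolding rank_cond_def by blast
    then show ?thesis by (auto simp: of_bool_def split: if_splits)
  qed
  have mono: "sub_le z r \<subseteq> sub_le z s" if "r \<le> s" for r s using that by (auto simp: sub_le_def)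
  have mem: "v \<in> sub_le z r" if "z $ v \<le> r" for v r using that by (auto simp: sub_le_def)
  have pos: "0 \<le> z $ v" for v
  proof (rule ccontr)
    assume "\<not> 0 \<le> z $ v"
    then have "comp_count E (sub_le z (z $ v)) (sub_le z (z $ v)) = 0" using F[of "z $ v" "z $ v"] by simp
    then show False using mem[of v "z $ v"] unfolding comp_count_alt[OF order_refl] by (simp add: card_eq_0_iff) 
  qed
  have "sub_le z 0 \<noteq> {}" using F[of 0 0] by auto
  then obtain a where a: "z $ a = 0" using pos by (auto simp: sub_le_def intro: order_antisym)
  obtain s where s: "1 \<le> s" "s < 4" "sub_lt z 4 = sub_le z s" using sub_lt_eq_sub_le[of 1 4 z] by auto
  have "comp_count E (sub_le z 1) (sub_le z s) = 2" using F[of 1 s] s by simp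
  then have "\<not> (\<forall>v\<in>sub_le z 1. path v a \<subseteq> sub_le z s)"
    using comp_count_eq_1[OF mono[of 1 s], of a] s mem[of a 1] a by auto
  then obtain b where b: "z $ b \<le> 1" "\<not> path b a \<subseteq> sub_le z s" by (auto simp: sub_le_def)
  have ab: "\<not> path a b \<subseteq> sub_le z r" if "r < 4" for r
  proof -
    have "sub_le z r \<subseteq> sub_lt z 4" using that by (auto simp: sub_lt_def sub_le_def)
    then show ?thesis using b(2) path_commute[of a b] s(3) by auto
  qed
  \<comment> \<open>The rank is 1 outside the window 1 \<le> r < 4, so the sublevel set is connected
    there.\<close>
  have one: "path v w \<subseteq> sub_le z r" if "z $ v \<le> r" "z $ w \<le> r" "r < 1 \<or> 4 \<le> r" for v w r
  proof -
    have "0 \<le> r" using pos[of v] that by simp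
    then have "comp_count E (sub_le z r) (sub_le z r) = 1" using F[of r r] that by auto
    then show ?thesis using comp_count_1D[OF _ order_refl] mem that by blast
  qed
  \<comment> \<open>Were the value of \<open>b\<close> below 1, connectedness at that level would
    join \<open>a\<close> and \<open>b\<close> too early.\<close>
  have zb: "z $ b = 1" using one[of a "z $ b" b] ab[of "z $ b"] a b pos[of b] by force
  have p4: "path a b \<subseteq> sub_le z 4" using one[of a 4 b] a zb by simp
  then obtain p where "p \<in> path a b" "z $ p = 4"
    using b(2) path_commute[of a b] s(3) by (force simp: sub_lt_def sub_le_def)
  moreover have "low z v a \<or> low z v b" for v
  proof (cases "z $ v < 1 \<or> 4 \<le> z $ v")
    case True
    then show ?thesis using one[of v "z $ v" a] a pos[of v] by (simp add: low_iff)
  next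
    case False
    then have "comp_count E (sub_le z (z $ v)) (sub_le z (z $ v)) = 2" using F[of "z $ v" "z $ v"] by simp
    then show ?thesis unfolding low_iff
      using comp_count_2D[OF _ order_refl, of "sub_le z (z $ v)" a b v] ab[of "z $ v"] False a zb mem by simp
  qed
  ultimately show "\<exists>a b. z $ a = 0 \<and> z $ b = 1 \<and> (\<exists>p\<in>path a b. z $ p = 4) \<and> two_wells z a b"
    using a zb p4 unfolding two_wells_def by (auto simp: sub_le_def)
next
  assume "\<exists>a b. z $ a = 0 \<and> z $ b = 1 \<and> (\<exists>p\<in>path a b. z $ p = 4) \<and> two_wells z a b"
  then obtain a b p where a: "z $ a = 0" and b: "z $ b = 1" and p: "p \<in> path a b" "z $ p = 4"
    and le4: "\<And>x. x \<in> path a b \<Longrightarrow> z $ x \<le> 4" and low: "\<And>v. low z v a \<or> low z v b"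
    unfolding two_wells_def by blast
  have pos: "0 \<le> z $ v" for v
  proof -
    have "z $ a \<le> z $ v \<or> z $ b \<le> z $ v" using low[of v] path_ends unfolding low_def by blast
    then show ?thesis using a b by auto
  qed
  show "rank_cond z" unfolding rank_cond_def
  proof (intro allI impI)
    fix r s :: real assume rs: "r \<le> s"
    have sub: "sub_le z r \<subseteq> sub_le z s" using rs by (auto simp: sub_le_def)
    have conn: "path v a \<subseteq> sub_le z s \<or> path v b \<subseteq> sub_le z s" if "z $ v \<le> r" for v
      using low[of v] that rs by (fastforce simp: low_def sub_le_def)
    consider "r < 0" | "0 \<le> r" "r < 1" | "0 \<le> r" "4 \<le> s" | "1 \<le> r" "s < 4" using rs by linarith
    then show "int (comp_count E (sub_le z r) (sub_le z s)) = of_bool (0 \<le> r) + of_bool (1 \<le> r \<and> s < 4)"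
    proof cases
      case 1
      then have "sub_le z r = {}" using pos by (auto simp: sub_le_def not_le intro: less_le_trans)
      then show ?thesis using 1 by simp
    next
      case 2
      have "path v a \<subseteq> sub_le z s" if "v \<in> sub_le z r" for v
      proof -
        have "\<not> low z v b" using that 2 b by (auto simp: low_def sub_le_def intro!: bexI[of _ b])
        then show ?thesis using low[of v] that rs by (fastforce simp: low_def sub_le_def)
      qed
      then have "comp_count E (sub_le z r) (sub_le z s) = 1"
        using 2 a by (intro comp_count_eq_1[OF sub, of a]) (auto simp: sub_le_def)
      then show ?thesis using 2 by simp
    next
      case 3
      have "path a b \<subseteq> sub_le z s" using le4 3 by (force simp: sub_le_def)
      then have "path v a \<subseteq> sub_le z s" if "v \<in> sub_le z r" for v
        using conn[of v] that path_triangle[of v a b] path_commute[of a b] by (auto simp: sub_le_def subset_iff)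
      then have "comp_count E (sub_le z r) (sub_le z s) = 1"
        using 3 a by (intro comp_count_eq_1[OF sub, of a]) (auto simp: sub_le_def)
      then show ?thesis using 3 by simp
    next
      case 4
      have "\<not> path a b \<subseteq> sub_le z s" using p 4 by (auto simp: sub_le_def)
      then have "comp_count E (sub_le z r) (sub_le z s) = 2"
        using 4 a b conn by (intro comp_count_eq_2[OF sub, of a b]) (auto simp: sub_le_def)
      then show ?thesis using 4 by simp
    qed
  qed
qed

lemma data_iff_wells:
  "z \<in> data E {#(0, \<infinity>), (1, 4)#} \<longleftrightarrow>
     (\<exists>a b. z $ a = 0 \<and> z $ b = 1 \<and> (\<exists>p\<in>path a b. z $ p = 4) \<and> two_wells z a b)"
  unfolding data_def mem_Collect_eq PH0_eq_iff_rank_cond rank_cond_iff_wells by (rule refl)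

end

section \<open>Decomposition into cells\<close>

context star_tree begin

text \<open>Which of the two wells a vertex is monotone towards is decided by its position relative to \<open>p\<close> rather
  than by \<open>z\<close>; this is what makes the cell convex.\<close>

definition cell :: "'v \<Rightarrow> real \<Rightarrow> 'v \<Rightarrow> 'v \<Rightarrow> real \<Rightarrow> (real^'v) set" where
  "cell a \<alpha> p b \<beta> = {z. z $ a = \<alpha> \<and> z $ b = \<beta> \<and> z $ p = 4 \<and>
     (\<forall>v. (p \<in> path v b \<longrightarrow> low z v a) \<and> (p \<in> path v a \<longrightarrow> low z v b))}"

lemma cellD:
  assumes "z \<in> cell a \<alpha> p b \<beta>"
  shows "z $ a = \<alpha>" "z $ b = \<beta>" "z $ p = 4"
    "\<And>v x. p \<in> path v b \<Longrightarrow> x \<in> path v a \<Longrightarrow> z $ x \<le> z $ v"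
    "\<And>v x. p \<in> path v a \<Longrightarrow> x \<in> path v b \<Longrightarrow> z $ x \<le> z $ v"
  using assms by (auto simp: cell_def low_def)

lemma cell_commute: "cell a \<alpha> p b \<beta> = cell b \<beta> p a \<alpha>"
  by (auto simp: cell_def)

lemma cell_as_Inter:
  "cell a \<alpha> p b \<beta> = {z. z $ a = \<alpha>} \<inter> {z. z $ b = \<beta>} \<inter> {z. z $ p = 4} \<inter>
     (\<Inter>v\<in>{v. p \<in> path v b}. \<Inter>x\<in>path v a. {z. z $ x \<le> z $ v}) \<inter>
     (\<Inter>v\<in>{v. p \<in> path v a}. \<Inter>x\<in>path v b. {z. z $ x \<le> z $ v})"
  by (auto simp: cell_def low_def)

lemma convex_cell: "convex (cell a \<alpha> p b \<beta>)"
proof -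
  have eq: "convex {z :: real^'v. z $ x = r}" for x r
    by (auto simp: convex_def simp flip: distrib_right)
  have le: "convex {z :: real^'v. z $ x \<le> z $ v}" for x v
    by (auto simp: convex_def intro!: add_mono mult_left_mono)
  show ?thesis unfolding cell_as_Inter by (intro convex_Int convex_INT eq le)
qed

lemma closed_cell: "closed (cell a \<alpha> p b \<beta>)"
proof -
  have eq: "closed {z :: real^'v. z $ x = r}" for x r by (intro closed_Collect_eq continuous_intros)
  have le: "closed {z :: real^'v. z $ x \<le> z $ v}" for x v by (intro closed_Collect_le continuous_intros)
  show ?thesis unfolding cell_as_Inter by (intro closed_Int closed_INT ballI eq le)
qed

text \<open>This allows the peak of a vector to be moved: only the value 4 at the new position on
  the same path has to be checked.\<close>

lemma cell_iff:
  assumes p: "p \<in> path a b"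
  shows "z \<in> cell a \<alpha> p b \<beta> \<longleftrightarrow> z $ a = \<alpha> \<and> z $ b = \<beta> \<and> z $ p = 4 \<and> two_wells z a b"
proof
  assume z: "z \<in> cell a \<alpha> p b \<beta>"
  have "z $ x \<le> 4" if "x \<in> path a b" for x
  proof -
    have "x \<in> path p a \<or> x \<in> path p b" using that path_triangle[of a b p] path_commute[of a p] by auto
    then show ?thesis using cellD[OF z] path_ends by metis
  qed
  moreover have "low z v a \<or> low z v b" for v
    using p path_triangle[of a b v] path_commute[of a v] z by (auto simp: cell_def)
  ultimately show "z $ a = \<alpha> \<and> z $ b = \<beta> \<and> z $ p = 4 \<and> two_wells z a b"
    using cellD(1-3)[OF z] by (auto simp: two_wells_def)
next
  assume z: "z $ a = \<alpha> \<and> z $ b = \<beta> \<and> z $ p = 4 \<and> two_wells z a b"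
  have le4: "z $ x \<le> 4" if "x \<in> path a b" for x using z that by (auto simp: two_wells_def)
  \<comment> \<open>If \<open>v\<close> is low towards the well across \<open>p\<close>, its value
    is at least 4 and dominates the whole path between the wells, so \<open>v\<close> is low towards
    the near well too.\<close>
  have key: "low z v a" if "p \<in> path v b" "path a b = path b a" "low z v a \<or> low z v b" "\<And>x. x \<in> path a b \<Longrightarrow> z $ x \<le> 4"
    for v a b
    using that(3)
  proof
    assume l: "low z v b"
    then have v4: "4 \<le> z $ v" using that(1) z by (auto simp: low_def)
    show ?thesis unfolding low_def
    proof
      fix x assume "x \<in> path v a"
      then have "x \<in> path v b \<or> x \<in> path a b" using path_triangle[of v a b] that(2) by auto
      then show "z $ x \<le> z $ v" using l that(4)[of x] v4 by (auto simp: low_def)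
    qed
  qed
  have "low z v a \<or> low z v b" for v using z by (auto simp: two_wells_def)
  then show "z \<in> cell a \<alpha> p b \<beta>"
    unfolding cell_def using z key[of _ b a] key[of _ a b] le4 path_commute[of a b] by blast
qed

definition cells :: "'v set \<Rightarrow> real \<Rightarrow> 'v \<Rightarrow> 'v set \<Rightarrow> real \<Rightarrow> (real^'v) set" where
  "cells A \<alpha> p B \<beta> = (\<Union>a\<in>A. \<Union>b\<in>B. cell a \<alpha> p b \<beta>)"

lemma cellsI: "a \<in> A \<Longrightarrow> b \<in> B \<Longrightarrow> z \<in> cell a \<alpha> p b \<beta> \<Longrightarrow> z \<in> cells A \<alpha> p B \<beta>"
  by (auto simp: cells_def)

lemma cellsE:
  assumes "z \<in> cells A \<alpha> p B \<beta>"
  obtains a b where "a \<in> A" "b \<in> B" "z \<in> cell a \<alpha> p b \<beta>"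
  using assms by (auto simp: cells_def)

lemma cells_commute: "cells A \<alpha> p B \<beta> = cells B \<beta> p A \<alpha>"
proof -
  have "cells A \<alpha> p B \<beta> \<subseteq> cells B \<beta> p A \<alpha>" for A B \<alpha> \<beta>
  proof
    fix z assume "z \<in> cells A \<alpha> p B \<beta>"
    then obtain a b where "a \<in> A" "b \<in> B" "z \<in> cell a \<alpha> p b \<beta>" by (rule cellsE)
    then show "z \<in> cells B \<beta> p A \<alpha>" using cellsI[of b B a A] cell_commute[of a \<alpha> p b \<beta>] by simp
  qed
  then show ?thesis by blast
qed

definition path_convex :: "'v set \<Rightarrow> bool" where
  "path_convex A \<longleftrightarrow> (\<forall>v\<in>A. \<forall>w\<in>A. path v w \<subseteq> A)"

lemma closed_cells: "closed (cells A \<alpha> p B \<beta>)"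
  unfolding cells_def by (intro closed_UN finite ballI closed_cell)

text \<open>The vector depends on \<open>A\<close> and \<open>B\<close> only, so it lies in all
  cells with wells in these regions and peak outside them.\<close>

lemma cell_common_point:
  assumes "path_convex A" "path_convex B" "A \<inter> B = {}" "p \<notin> A" "p \<notin> B" "a \<in> A" "b \<in> B" "\<alpha> \<le> 4" "\<beta> \<le> 4"
  shows "(\<chi> v. if v \<in> A then \<alpha> else if v \<in> B then \<beta> else 4) \<in> cell a \<alpha> p b \<beta>"
proof -
  have A: "x \<in> A" if "v \<in> A" "w \<in> A" "x \<in> path v w" for v w x using assms(1) that by (auto simp: path_convex_def)
  have B: "x \<in> B" if "v \<in> B" "w \<in> B" "x \<in> path v w" for v w x using assms(2) that by (auto simp: path_convex_def)
  have "b \<notin> A" using assms by auto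
  let ?z = "(\<chi> v. if v \<in> A then \<alpha> else if v \<in> B then \<beta> else 4) :: real^'v"
  have "low ?z v a" if "p \<in> path v b" for v
  proof -
    have "v \<notin> B" using B[of v b p] that assms by blast
    then show ?thesis using A[of v a] assms(6,8,9) by (cases "v \<in> A") (auto simp: low_def)
  qed
  moreover have "low ?z v b" if "p \<in> path v a" for v
  proof -
    have "v \<notin> A" using A[of v a p] that assms by blast
    moreover have "x \<notin> A" if "x \<in> path v b" "v \<in> B" for x using B[of v b x] that assms by blast
    ultimately show ?thesis using B[of v b] assms(7,8,9) by (cases "v \<in> B") (auto simp: low_def)
  qed
  ultimately show ?thesis using assms \<open>b \<notin> A\<close> by (simp add: cell_def)
qed

text \<open>Once \<open>shrink\<close> confines the wells of overlapping cells to common regions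
  \<open>A\<close> and \<open>B\<close>, the intersection is a finite union of convex sets with the
  common point above.\<close>

lemma AR_cells_Int:
  assumes conv: "path_convex A" "path_convex B" "A \<inter> B = {}" "A \<noteq> {}" "B \<noteq> {}" "\<alpha> \<le> 4" "\<beta> \<le> 4"
    and p: "p \<notin> A" "p \<notin> B" "p' \<notin> A" "p' \<notin> B"
    and sub: "A \<subseteq> A1" "A \<subseteq> A2" "B \<subseteq> B1" "B \<subseteq> B2"
    and shrink: "\<And>a b a' b' z. \<lbrakk>a \<in> A1; b \<in> B1; a' \<in> A2; b' \<in> B2; z \<in> cell a \<alpha> p b \<beta>; z \<in> cell a' \<alpha> p' b' \<beta>\<rbrakk>
       \<Longrightarrow> a \<in> A \<and> a' \<in> A \<and> b \<in> B \<and> b' \<in> B"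
  shows "AR (cells A1 \<alpha> p B1 \<beta> \<inter> cells A2 \<alpha> p' B2 \<beta>)"
proof -
  define C where "C = (\<lambda>(a,b,a',b'). cell a \<alpha> p b \<beta> \<inter> cell a' \<alpha> p' b' \<beta>)"
  have "cells A1 \<alpha> p B1 \<beta> \<inter> cells A2 \<alpha> p' B2 \<beta> = (\<Union>q\<in>A \<times> B \<times> A \<times> B. C q)"
  proof (intro equalityI subsetI)
    fix z assume "z \<in> cells A1 \<alpha> p B1 \<beta> \<inter> cells A2 \<alpha> p' B2 \<beta>"
    then obtain a b a' b' where "a \<in> A1" "b \<in> B1" "a' \<in> A2" "b' \<in> B2"
      "z \<in> cell a \<alpha> p b \<beta>" "z \<in> cell a' \<alpha> p' b' \<beta>" by (auto simp: cells_def)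
    moreover have "a \<in> A \<and> a' \<in> A \<and> b \<in> B \<and> b' \<in> B" using shrink calculation by blast
    ultimately show "z \<in> (\<Union>q\<in>A \<times> B \<times> A \<times> B. C q)"
      by (intro UN_I[of "(a,b,a',b')"]) (auto simp: C_def)
  next
    fix z assume "z \<in> (\<Union>q\<in>A \<times> B \<times> A \<times> B. C q)"
    then obtain a b a' b' where "a \<in> A" "b \<in> B" "a' \<in> A" "b' \<in> B"
      "z \<in> cell a \<alpha> p b \<beta>" "z \<in> cell a' \<alpha> p' b' \<beta>" by (auto simp: C_def)
    then show "z \<in> cells A1 \<alpha> p B1 \<beta> \<inter> cells A2 \<alpha> p' B2 \<beta>"
      using sub by (intro IntI cellsI[of a A1 b B1] cellsI[of a' A2 b' B2]) auto
  qed
  moreover have "AR (\<Union>q\<in>A \<times> B \<times> A \<times> B. C q)"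
  proof (rule AR_Union_convex_common_point)
    show "(\<chi> v. if v \<in> A then \<alpha> else if v \<in> B then \<beta> else 4) \<in> C q" if "q \<in> A \<times> B \<times> A \<times> B" for q
      using that conv p by (auto simp: C_def intro!: cell_common_point)
  qed (use conv in \<open>auto simp: C_def closed_cell convex_cell intro!: closed_Int convex_Int\<close>)
  ultimately show ?thesis by simp
qed

lemma AR_cells:
  assumes "path_convex A" "path_convex B" "A \<inter> B = {}" "A \<noteq> {}" "B \<noteq> {}" "\<alpha> \<le> 4" "\<beta> \<le> 4" "p \<notin> A" "p \<notin> B"
  shows "AR (cells A \<alpha> p B \<beta>)"
  using AR_cells_Int[of A B \<alpha> \<beta> p p A A B B] assms by auto

section \<open>Towers: the peak slides along a branch\<close>

text \<open>For \<open>p \<noteq> c\<close>, \<open>outer p\<close> and \<open>inner p\<close> are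
  the two sides left after removing \<open>p\<close>.\<close>

definition outer :: "'v \<Rightarrow> 'v set" where "outer p = {v. anc p v \<and> v \<noteq> p}"
definition inner :: "'v \<Rightarrow> 'v set" where "inner p = {v. \<not> anc p v}"
definition branch :: "nat \<Rightarrow> 'v set" where "branch i = {v. v \<noteq> c \<and> br v = i}"

lemma not_anc_c: "p \<noteq> c \<Longrightarrow> \<not> anc p c" by (simp add: anc_def)

lemma path_convex_outer: assumes "p \<noteq> c" shows "path_convex (outer p)"
  unfolding path_convex_def
proof (intro ballI subsetI)
  fix v w x assume *: "v \<in> outer p" "w \<in> outer p" "x \<in> path v w"
  then have vw: "anc p v" "anc p w" "v \<noteq> p" "w \<noteq> p" by (auto simp: outer_def)
  then have "v \<noteq> c" "w \<noteq> c" "br v = br w" using assms by (auto simp: anc_def)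
  then have "x \<noteq> c" using * by (auto simp: c_in_path_iff)
  then have x: "anc x v \<noteq> anc x w \<or> x = v \<or> x = w" using * in_path_iff by blast
  show "x \<in> outer p"
  proof (cases "x = v \<or> x = w")
    case True
    then show ?thesis using * by auto
  next
    case False
    then have "anc x v \<and> \<not> anc x w \<or> anc x w \<and> \<not> anc x v" using x by auto
    then have "\<not> anc x p" using anc_trans vw by blast
    moreover have "anc x p \<or> anc p x" using anc_linear vw \<open>anc x v \<and> \<not> anc x w \<or> anc x w \<and> \<not> anc x v\<close> by blast
    ultimately show ?thesis by (auto simp: outer_def)
  qed
qed

lemma path_convex_inner: assumes "p \<noteq> c" shows "path_convex (inner p)"
  unfolding path_convex_def
proof (intro ballI subsetI)
  fix v w x assume *: "v \<in> inner p" "w \<in> inner p" "x \<in> path v w"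
  show "x \<in> inner p"
  proof (cases "x = c")
    case True
    then show ?thesis using not_anc_c[OF assms] by (simp add: inner_def)
  next
    case False
    then have "anc x v \<or> anc x w" using * in_path_iff[of x v w] by auto
    then show ?thesis using * anc_trans[of p x] by (auto simp: inner_def)
  qed
qed

lemma path_convex_branch: "path_convex (branch i)"
  unfolding path_convex_def
proof (intro ballI subsetI)
  fix v w x assume *: "v \<in> branch i" "w \<in> branch i" "x \<in> path v w"
  then have "x \<noteq> c" by (auto simp: c_in_path_iff branch_def)
  then have "anc x v \<or> anc x w" using * in_path_iff[of x v w] by auto
  then show "x \<in> branch i" using * \<open>x \<noteq> c\<close> by (auto simp: branch_def anc_def)
qed

lemma in_path_outer_inner: "p \<noteq> c \<Longrightarrow> v \<in> outer p \<Longrightarrow> w \<in> inner p \<Longrightarrow> p \<in> path v w"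
  by (auto simp: in_path_iff outer_def inner_def)

lemma c_in_path_branches: "v \<in> branch i \<Longrightarrow> w \<in> branch j \<Longrightarrow> i \<noteq> j \<Longrightarrow> c \<in> path v w"
  by (auto simp: branch_def c_in_path_iff)

definition height :: "nat \<Rightarrow> nat" where "height i = Max (dp ` branch i)"
definition node :: "nat \<Rightarrow> nat \<Rightarrow> 'v" where "node i m = (SOME v. v \<in> branch i \<and> dp v = m)"

lemma dp_le_height: "v \<in> branch i \<Longrightarrow> dp v \<le> height i"
  unfolding height_def by (intro Max_ge) auto

lemma branch_has_depth_2: assumes "i < n" obtains w where "w \<in> branch i" "dp w = 2"
proof -
  obtain w where "br w = i" "dp w = 2" using depth_2_ex assms by blast
  moreover have "w \<noteq> c" using dp_eq_0[of w] \<open>dp w = 2\<close> by auto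
  ultimately show ?thesis using that by (auto simp: branch_def)
qed

lemma height_ge_2: "i < n \<Longrightarrow> 2 \<le> height i"
  using branch_has_depth_2 dp_le_height by metis

lemma node_props:
  assumes "i < n" "1 \<le> m" "m \<le> height i"
  shows "node i m \<in> branch i" "dp (node i m) = m"
proof -
  have "\<exists>v\<in>branch i. dp v = height i - k" if "k < height i" for k
    using that
  proof (induction k)
    case 0
    have "dp ` branch i \<noteq> {}" using branch_has_depth_2[OF assms(1)] by blast
    then have "height i \<in> dp ` branch i" unfolding height_def by (intro Max_in) auto
    then show ?case by force
  next
    case (Suc k)
    then obtain v where v: "v \<in> branch i" "dp v = height i - k" by auto
    then obtain w where "w \<noteq> c" "br w = br v" "Suc (dp w) = dp v"
      using parent_ex[of v] Suc.prems by (fastforce simp: branch_def)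
    then show ?case using v by (intro bexI[of _ w]) (auto simp: branch_def)
  qed
  from this[of "height i - m"] have "\<exists>v. v \<in> branch i \<and> dp v = m" using assms by auto
  from someI_ex[OF this] show "node i m \<in> branch i" "dp (node i m) = m" by (auto simp: node_def)
qed

lemma node_dp: assumes "v \<in> branch i" shows "node i (dp v) = v"
proof -
  have "\<exists>w. w \<in> branch i \<and> dp w = dp v" using assms by blast
  from someI_ex[OF this] have "node i (dp v) \<in> branch i \<and> dp (node i (dp v)) = dp v" by (simp add: node_def)
  then show ?thesis using label_inj[of v "node i (dp v)"] assms by (auto simp: branch_def)
qed

lemma anc_in_branch: "v \<in> branch i \<Longrightarrow> w \<in> branch i \<Longrightarrow> anc v w \<longleftrightarrow> dp v \<le> dp w"
  by (auto simp: branch_def anc_def)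

lemma outer_iff: "p \<in> branch i \<Longrightarrow> v \<in> outer p \<longleftrightarrow> v \<in> branch i \<and> dp p < dp v"
  using label_inj[of p v] by (auto simp: outer_def branch_def anc_def le_less)

lemma inner_iff: "p \<in> branch i \<Longrightarrow> v \<in> inner p \<longleftrightarrow> \<not> (v \<in> branch i \<and> dp p \<le> dp v)"
  by (auto simp: inner_def branch_def anc_def)

text \<open>The peak runs through the depths 1 to \<open>height i - 1\<close>, leaving room for a
  well beyond it. The well values are parameters because both orders of 0 and 1 occur.\<close>

definition tower :: "nat \<Rightarrow> real \<Rightarrow> real \<Rightarrow> (real^'v) set" where
  "tower i \<alpha> \<beta> = (\<Union>m\<le>height i - 2. cells (outer (node i (Suc m))) \<alpha> (node i (Suc m)) (inner (node i (Suc m))) \<beta>)"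

lemma closed_tower: "closed (tower i \<alpha> \<beta>)"
  unfolding tower_def by (intro closed_UN ballI closed_cells) auto

lemma towerE:
  assumes "z \<in> tower i \<alpha> \<beta>" "i < n"
  obtains a p b where "p \<in> branch i" "a \<in> outer p" "b \<in> inner p" "z \<in> cell a \<alpha> p b \<beta>"
proof -
  obtain m where m: "m \<le> height i - 2"
    "z \<in> cells (outer (node i (Suc m))) \<alpha> (node i (Suc m)) (inner (node i (Suc m))) \<beta>"
    using assms by (auto simp: tower_def)
  moreover have "node i (Suc m) \<in> branch i" using m height_ge_2[OF assms(2)] by (intro node_props assms) auto
  ultimately show ?thesis using that cellsE by metis
qed

lemma towerI:
  assumes "p \<in> branch i" "a \<in> outer p" "b \<in> inner p" "z \<in> cell a \<alpha> p b \<beta>"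
  shows "z \<in> tower i \<alpha> \<beta>"
proof -
  have "dp p \<noteq> 0" using assms(1) dp_eq_0 by (auto simp: branch_def)
  then obtain m where m: "dp p = Suc m" using not0_implies_Suc by blast
  have "dp p < height i" using assms(1,2) outer_iff dp_le_height[of a i] by fastforce
  then have "m \<le> height i - 2" using m by simp
  moreover have "node i (Suc m) = p" using node_dp[OF assms(1)] m by simp
  ultimately have "z \<in> cells (outer (node i (Suc m))) \<alpha> (node i (Suc m)) (inner (node i (Suc m))) \<beta>"
    using assms cellsI by simp
  then show ?thesis unfolding tower_def using \<open>m \<le> height i - 2\<close> by blast
qed

text \<open>A vector admitting two peak positions on the branch admits all positions between them,
  which is the running intersection property for a chain.\<close>

lemma AR_tower:
  assumes i: "i < n" and ab: "\<alpha> < 4" "\<beta> < 4"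
  shows "AR (tower i \<alpha> \<beta>)"
  unfolding tower_def
proof (rule AR_Un_chain)
  have h: "2 \<le> height i" by (rule height_ge_2[OF i])
  have nd: "node i (Suc m) \<in> branch i" "dp (node i (Suc m)) = Suc m" if "m < height i" for m
    using node_props[OF i, of "Suc m"] that by auto
  have nc: "node i (Suc m) \<noteq> c" if "m < height i" for m using nd(1)[OF that] by (simp add: branch_def)
  have out_ne: "outer (node i (Suc m)) \<noteq> {}" if "Suc m < height i" for m
  proof -
    have "node i (Suc (Suc m)) \<in> outer (node i (Suc m))" using nd[of m] nd[of "Suc m"] that by (simp add: outer_iff)
    then show ?thesis by blast
  qed
  have in_ne: "inner (node i (Suc m)) \<noteq> {}" if "m < height i" for m
    using not_anc_c[OF nc[OF that]] by (auto simp: inner_def)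
  show "AR (cells (outer (node i (Suc m))) \<alpha> (node i (Suc m)) (inner (node i (Suc m))) \<beta>)"
    if "m \<le> height i - 2" for m
  proof (rule AR_cells)
    have "Suc m < height i" using that h by simp
    then show "outer (node i (Suc m)) \<noteq> {}" "inner (node i (Suc m)) \<noteq> {}"
      "path_convex (outer (node i (Suc m)))" "path_convex (inner (node i (Suc m)))"
      using out_ne in_ne nc path_convex_outer path_convex_inner by simp_all
  qed (use ab in \<open>auto simp: outer_def inner_def\<close>)
  show "closed (cells (outer (node i (Suc m))) \<alpha> (node i (Suc m)) (inner (node i (Suc m))) \<beta>)" for m
    by (rule closed_cells)
  show "AR (cells (outer (node i (Suc m))) \<alpha> (node i (Suc m)) (inner (node i (Suc m))) \<beta> \<inter>
          cells (outer (node i (Suc (Suc m)))) \<alpha> (node i (Suc (Suc m))) (inner (node i (Suc (Suc m)))) \<beta>)"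
    if "m < height i - 2" for m
  proof -
    define p where "p = node i (Suc m)"
    define p' where "p' = node i (Suc (Suc m))"
    have mh: "Suc (Suc m) < height i" using that by simp
    have p: "p \<in> branch i" "dp p = Suc m" and p': "p' \<in> branch i" "dp p' = Suc (Suc m)"
      using nd[of m] nd[of "Suc m"] mh by (auto simp: p_def p'_def)
    show ?thesis unfolding p_def[symmetric] p'_def[symmetric]
    proof (rule AR_cells_Int[where A = "outer p'" and B = "inner p"])
      show "path_convex (outer p')" "path_convex (inner p)"
        using p p' by (auto simp: branch_def intro!: path_convex_outer path_convex_inner)
      show "outer p' \<noteq> {}" using out_ne[of "Suc m"] mh by (simp add: p'_def)
      show "inner p \<noteq> {}" using in_ne[of m] mh by (simp add: p_def)
      fix a b a' b' z assume *: "a \<in> outer p" "b \<in> inner p" "a' \<in> outer p'" "b' \<in> inner p'"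
        "z \<in> cell a \<alpha> p b \<beta>" "z \<in> cell a' \<alpha> p' b' \<beta>"
      \<comment> \<open>Wells have values below 4 and so avoid both peaks; this confines them to
        \<open>outer p'\<close> and \<open>inner p\<close>.\<close>
      have "a \<noteq> p'" using cellD(1)[OF *(5)] cellD(3)[OF *(6)] ab by auto
      then have "a \<in> outer p'"
        using *(1) p p' label_inj[of a p'] by (fastforce simp: outer_iff branch_def)
      moreover have "b' \<noteq> p" using cellD(2)[OF *(6)] cellD(3)[OF *(5)] ab by auto
      then have "b' \<in> inner p"
        using *(4) p p' label_inj[of b' p] by (fastforce simp: inner_iff branch_def)
      ultimately show "a \<in> outer p' \<and> a' \<in> outer p' \<and> b \<in> inner p \<and> b' \<in> inner p" using * by simp
    qed (use ab p p' in \<open>auto simp: outer_iff inner_iff\<close>)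
  qed
  show "cells (outer (node i (Suc l))) \<alpha> (node i (Suc l)) (inner (node i (Suc l))) \<beta> \<inter>
          cells (outer (node i (Suc (Suc m)))) \<alpha> (node i (Suc (Suc m))) (inner (node i (Suc (Suc m)))) \<beta>
        \<subseteq> cells (outer (node i (Suc m))) \<alpha> (node i (Suc m)) (inner (node i (Suc m))) \<beta>"
    if "l \<le> m" "m < height i - 2" for l m
  proof
    define p where "p = node i (Suc l)"
    define q where "q = node i (Suc m)"
    define p' where "p' = node i (Suc (Suc m))"
    have p: "p \<in> branch i" "dp p = Suc l" and p': "p' \<in> branch i" "dp p' = Suc (Suc m)"
      and q: "q \<in> branch i" "dp q = Suc m"
      using nd[of l] nd[of m] nd[of "Suc m"] that by (auto simp: p_def p'_def q_def)
    have nc3: "p \<noteq> c" "p' \<noteq> c" "q \<noteq> c" using p p' q by (auto simp: branch_def)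
    fix z assume "z \<in> cells (outer (node i (Suc l))) \<alpha> (node i (Suc l)) (inner (node i (Suc l))) \<beta> \<inter>
          cells (outer (node i (Suc (Suc m)))) \<alpha> (node i (Suc (Suc m))) (inner (node i (Suc (Suc m)))) \<beta>"
    then obtain a b a' b' where *: "a \<in> outer p" "b \<in> inner p" "a' \<in> outer p'" "b' \<in> inner p'"
        "z \<in> cell a \<alpha> p b \<beta>" "z \<in> cell a' \<alpha> p' b' \<beta>"
      unfolding p_def[symmetric] p'_def[symmetric] by (auto elim!: cellsE)
    have "a' \<in> outer p" using *(3) p p' that by (simp add: outer_iff)
    then have "p \<in> path a' b" using in_path_outer_inner nc3 * by blast
    \<comment> \<open>From \<open>a'\<close> to \<open>a\<close> the values stay at most
      \<open>\<alpha>\<close>, which is below the value 4 at \<open>p'\<close>.\<close>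
    then have "p' \<notin> path a' a" using cellD(4)[OF *(5)] cellD(1)[OF *(6)] cellD(3)[OF *(6)] ab by force
    then have a: "anc p' a" "a \<noteq> p'" using *(3) nc3 by (auto simp: in_path_iff outer_def)
    then have aq: "a \<in> outer p'" "a \<in> outer q" using p' q by (auto simp: outer_def anc_in_branch outer_iff branch_def anc_def)
    have bq: "b \<in> inner q" using *(2) p q that by (auto simp: inner_iff)
    have qab: "q \<in> path a b" using in_path_outer_inner nc3 aq bq by blast
    have pab: "p \<in> path a b" using in_path_outer_inner nc3 * by blast
    have tw: "two_wells z a b" using cell_iff[OF pab] *(5) by blast
    \<comment> \<open>A vertex \<open>q\<close> beyond \<open>p\<close> is low towards
      \<open>a\<close>, and its path to \<open>a\<close> crosses \<open>p'\<close>.\<close>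
    have "4 \<le> z $ q"
    proof (cases "q = p")
      case True
      then show ?thesis using cellD(3)[OF *(5)] by simp
    next
      case False
      then have "q \<in> outer p" using p q that label_inj[of p q] by (auto simp: outer_iff branch_def le_less)
      then have "p \<in> path q b" using in_path_outer_inner nc3 * by blast
      moreover have "p' \<in> path q a" using a p' q nc3 by (auto simp: in_path_iff anc_in_branch)
      ultimately show ?thesis using cellD(4)[OF *(5)] cellD(3)[OF *(6)] by force
    qed
    then have "z $ q = 4" using tw qab by (auto simp: two_wells_def intro: order_antisym)
    then have "z \<in> cell a \<alpha> q b \<beta>" using cell_iff[OF qab] cell_iff[OF pab] *(5) by blast
    then show "z \<in> cells (outer (node i (Suc m))) \<alpha> (node i (Suc m)) (inner (node i (Suc m))) \<beta>"
      using aq bq cellsI unfolding q_def by blast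
  qed
qed

section \<open>Saddles: the peak at the centre\<close>

definition saddle :: "nat \<Rightarrow> real \<Rightarrow> nat \<Rightarrow> real \<Rightarrow> (real^'v) set" where
  "saddle i \<alpha> j \<beta> = cells (branch i) \<alpha> c (branch j) \<beta>"

lemma saddle_commute: "saddle i \<alpha> j \<beta> = saddle j \<beta> i \<alpha>"
  unfolding saddle_def by (rule cells_commute)

lemma closed_saddle: "closed (saddle i \<alpha> j \<beta>)"
  unfolding saddle_def by (rule closed_cells)

lemma branch_nonempty: "i < n \<Longrightarrow> branch i \<noteq> {}"
  using branch_has_depth_2 by blast

lemma AR_saddle:
  assumes "i < n" "j < n" "i \<noteq> j" "\<alpha> < 4" "\<beta> < 4"
  shows "AR (saddle i \<alpha> j \<beta>)"
  unfolding saddle_def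
  by (rule AR_cells) (use assms branch_nonempty path_convex_branch in \<open>auto simp: branch_def\<close>)

text \<open>A peak on the branch and a peak at \<open>c\<close> force the value 4 between them, in
  particular at the neighbour \<open>q\<close> of \<open>c\<close>. Hence only the lowest level of
  the tower meets the saddle.\<close>

lemma AR_tower_Int_saddle:
  assumes ij: "i < n" "j < n" "i \<noteq> j" and ab: "\<alpha> < 4" "\<beta> < 4"
  shows "AR (tower i \<alpha> \<beta> \<inter> saddle i \<alpha> j \<beta>)"
proof -
  define q where "q = node i 1"
  have h: "2 \<le> height i" by (rule height_ge_2[OF ij(1)])
  have q: "q \<in> branch i" "dp q = 1" using node_props[OF ij(1), of 1] h by (auto simp: q_def)
  have qc: "q \<noteq> c" using q by (auto simp: branch_def)
  have oq: "v \<in> outer q" if "v \<in> branch i" "v \<noteq> q" for v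
  proof -
    have "dp v \<noteq> 0" "dp v \<noteq> 1" using that dp_eq_0[of v] label_inj[of v q] q by (auto simp: branch_def)
    then show ?thesis using that q by (simp add: outer_iff)
  qed
  have bjq: "v \<in> inner q" if "v \<in> branch j" for v using that q ij by (auto simp: inner_iff branch_def)
  let ?V = "cells (outer q) \<alpha> q (inner q) \<beta>"
  have sub: "z \<in> ?V" if z: "z \<in> tower i \<alpha> \<beta>" "z \<in> saddle i \<alpha> j \<beta>" for z
  proof -
    obtain a p b where p: "p \<in> branch i" "a \<in> outer p" "b \<in> inner p" "z \<in> cell a \<alpha> p b \<beta>"
      using towerE[OF z(1) ij(1)] .
    obtain a' b' where *: "a' \<in> branch i" "b' \<in> branch j" "z \<in> cell a' \<alpha> c b' \<beta>"
      using z(2) by (auto simp: saddle_def cells_def)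
    have pc: "p \<noteq> c" using p by (auto simp: branch_def)
    have "a \<in> branch i" using p outer_iff by blast
    then have "c \<in> path a b'" using *(2) ij c_in_path_branches by blast
    then have "p \<notin> path a a'" using cellD(4)[OF *(3)] cellD(1,3)[OF p(4)] ab by force
    then have pa': "anc p a'" using p pc by (auto simp: in_path_iff outer_def)
    have qab: "q \<in> path a' b'" using q qc *(1,2) bjq[OF *(2)] oq[OF *(1)] in_path_outer_inner[of q a' b']
      by (cases "a' = q") auto
    have cab: "c \<in> path a' b'" using * ij c_in_path_branches by blast
    have "4 \<le> z $ q"
    proof (cases "q = p")
      case True
      then show ?thesis using cellD(3)[OF p(4)] by simp
    next
      case False
      have "\<not> anc p q"
      proof
        assume "anc p q"
        moreover have "anc q p" using oq[OF p(1)] False by (auto simp: outer_def)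
        ultimately show False using anc_antisym False by blast
      qed
      then have "p \<in> path q a'" using pa' pc by (auto simp: in_path_iff)
      moreover have "c \<in> path q b'" using q * ij c_in_path_branches by blast
      ultimately show ?thesis using cellD(4)[OF *(3)] cellD(3)[OF p(4)] by force
    qed
    moreover have tw: "two_wells z a' b'" using cell_iff[OF cab] *(3) by blast
    ultimately have zq: "z $ q = 4" using qab by (auto simp: two_wells_def intro: order_antisym)
    then have "a' \<noteq> q" using cellD(1)[OF *(3)] ab by auto
    moreover have "z \<in> cell a' \<alpha> q b' \<beta>" using cell_iff[OF qab] cell_iff[OF cab] *(3) zq by blast
    ultimately show ?thesis using oq[OF *(1)] bjq[OF *(2)] cellsI by blast
  qed
  have "?V \<subseteq> tower i \<alpha> \<beta>" using towerI[OF q(1)] by (auto elim!: cellsE)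
  then have "tower i \<alpha> \<beta> \<inter> saddle i \<alpha> j \<beta> = ?V \<inter> saddle i \<alpha> j \<beta>" using sub by blast
  moreover have "AR (?V \<inter> saddle i \<alpha> j \<beta>)" unfolding saddle_def
  proof (rule AR_cells_Int[where A = "outer q" and B = "branch j"])
    show "outer q \<noteq> {}"
    proof -
      obtain w where "w \<in> branch i" "dp w = 2" using branch_has_depth_2[OF ij(1)] .
      then have "w \<in> outer q" using q by (simp add: outer_iff)
      then show ?thesis by blast
    qed
    show "outer q \<inter> branch j = {}" using q ij by (auto simp: outer_iff branch_def)
    show "outer q \<subseteq> branch i" using q by (auto simp: outer_iff)
    show "branch j \<subseteq> inner q" using bjq by blast
    show "q \<notin> branch j" using q ij by (auto simp: branch_def)
    show "c \<notin> outer q" "c \<notin> branch j" using q by (auto simp: outer_iff branch_def)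
    fix a b a' b' z assume *: "a \<in> outer q" "b \<in> inner q" "a' \<in> branch i" "b' \<in> branch j"
        "z \<in> cell a \<alpha> q b \<beta>" "z \<in> cell a' \<alpha> c b' \<beta>"
    have "a' \<noteq> q" using cellD(1)[OF *(6)] cellD(3)[OF *(5)] ab by auto
    then have "a' \<in> outer q" using oq * by blast
    \<comment> \<open>From a third branch, \<open>b\<close> would be low towards \<open>a'\<close>
      and its path there would cross \<open>c\<close>, of value 4.\<close>
    moreover have "b \<in> branch j"
    proof (rule ccontr)
      assume n: "b \<notin> branch j"
      have "b \<noteq> c" using cellD(3)[OF *(6)] cellD(2)[OF *(5)] ab by auto
      moreover have "b \<notin> branch i" using *(2) q dp_eq_0[of b] \<open>b \<noteq> c\<close> by (auto simp: inner_iff)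
      ultimately have "c \<in> path b b'" "c \<in> path b a'" using n *(3,4) by (auto simp: branch_def c_in_path_iff)
      then show False using cellD(4)[OF *(6)] cellD(3)[OF *(6)] cellD(2)[OF *(5)] ab by force
    qed
    ultimately show "a \<in> outer q \<and> a' \<in> outer q \<and> b \<in> branch j \<and> b' \<in> branch j" using * by simp
  qed (use ij ab qc path_convex_outer path_convex_branch branch_nonempty in \<open>auto simp: outer_def\<close>)
  ultimately show ?thesis by simp
qed

text \<open>The position of the wells relative to a peak does not depend on the choice of the triple \<open>(a, p, b)\<close>.\<close>

lemma cells_same_sides:
  assumes "z \<in> cell a 0 p b 1" "z \<in> cell a' 0 p' b' 1" "p \<in> path a b" "p' \<in> path a' b'"
  shows "p \<notin> path a a'" "p' \<notin> path a a'" "p \<notin> path b b'" "p' \<notin> path b b'"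
proof -
  \<comment> \<open>Otherwise \<open>a'\<close>, of value 0, would be low towards \<open>b\<close>,
    of value 1.\<close>
  have zero: "p \<notin> path a' a" if "z \<in> cell a 0 p b 1" "z \<in> cell a' 0 p' b' 1" for a p b a' p' b'
    using cellD(5)[OF that(1), of a' b] cellD(2)[OF that(1)] cellD(1)[OF that(2)] path_ends by force
  \<comment> \<open>Otherwise \<open>b'\<close> would be low towards \<open>a\<close>, bounding that
    path by 1; but the path contains \<open>p'\<close>, which does not lie between the two deep
    wells.\<close>
  have one: "p \<notin> path b' b"
    if "z \<in> cell a 0 p b 1" "z \<in> cell a' 0 p' b' 1" "p' \<in> path a' b'" for a p b a' p' b'
  proof
    assume "p \<in> path b' b"
    then have le: "z $ x \<le> 1" if "x \<in> path b' a" for x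
      using cellD(4)[OF \<open>z \<in> cell a 0 p b 1\<close>] cellD(2)[OF \<open>z \<in> cell a' 0 p' b' 1\<close>] that by metis
    have "p' \<in> path b' a"
      using that(3) path_triangle[of a' b' a] zero[OF that(2,1)] path_commute by blast
    then show False using le cellD(3)[OF that(2)] by force
  qed
  show "p \<notin> path a a'" "p' \<notin> path a a'" "p \<notin> path b b'" "p' \<notin> path b b'"
    using zero[OF assms(1,2)] zero[OF assms(2,1)] one[OF assms(1,2,4)] one[OF assms(2,1,3)] path_commute by blast+
qed

section \<open>The pieces and their overlaps\<close>

definition W_piece :: "nat \<Rightarrow> (real^'v) set" where "W_piece i = tower i 0 1"
text \<open>A saddle is a bridge between a deep and a shallow tower. Absorbing it into the shallow
  side turns the bridge into an overlap.\<close>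

definition U_piece :: "nat \<Rightarrow> (real^'v) set" where
  "U_piece j = tower j 1 0 \<union> (\<Union>i\<in>{..<n}-{j}. saddle i 0 j 1)"

lemma W_pieceE:
  assumes "z \<in> W_piece i" "i < n"
  obtains a p b where "p \<in> branch i" "a \<in> outer p" "b \<in> inner p" "z \<in> cell a 0 p b 1" "p \<in> path a b"
proof -
  obtain a p b where *: "p \<in> branch i" "a \<in> outer p" "b \<in> inner p" "z \<in> cell a 0 p b 1"
    using towerE assms unfolding W_piece_def by metis
  then have "p \<in> path a b" using in_path_outer_inner[of p a b] by (auto simp: branch_def)
  then show ?thesis using that * by blast
qed

lemma U_pieceE:
  assumes "z \<in> U_piece j" "j < n"
  obtains (tower) a p b where "p \<in> branch j" "b \<in> outer p" "a \<in> inner p" "z \<in> cell a 0 p b 1" "p \<in> path a b"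
    | (saddle) a b i where "i < n" "i \<noteq> j" "a \<in> branch i" "b \<in> branch j" "z \<in> cell a 0 c b 1" "c \<in> path a b"
proof (cases "z \<in> tower j 1 0")
  case True
  then obtain a p b where *: "p \<in> branch j" "b \<in> outer p" "a \<in> inner p" "z \<in> cell b 1 p a 0"
    using towerE assms(2) by metis
  then have "p \<in> path a b" using in_path_outer_inner[of p b a] path_commute[of a b] by (auto simp: branch_def)
  then show ?thesis using that(1) * cell_commute[of a 0 p b 1] by blast
next
  case False
  then obtain i where i: "i < n" "i \<noteq> j" "z \<in> saddle i 0 j 1" using assms by (auto simp: U_piece_def)
  then obtain a b where "a \<in> branch i" "b \<in> branch j" "z \<in> cell a 0 c b 1" by (auto simp: saddle_def cells_def)
  then show ?thesis using that(2) i c_in_path_branches by metis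
qed

lemma U_pieceE':
  assumes "z \<in> U_piece j" "j < n"
  obtains a p b where "b \<in> branch j" "z \<in> cell a 0 p b 1" "p \<in> path a b"
     "p \<in> branch j \<and> b \<in> outer p \<and> a \<in> inner p \<or> p = c \<and> a \<noteq> c \<and> br a \<noteq> j"
  using assms
proof (cases rule: U_pieceE)
  case (tower a p b)
  then show ?thesis using that[of b a p] outer_iff by blast
next
  case (saddle a b i)
  then show ?thesis using that[of b a c] by (auto simp: branch_def)
qed

lemma data_eq_pieces:
  "data E {#(0, \<infinity>), (1, 4)#} = (\<Union>j<n. U_piece j) \<union> (\<Union>i<n. W_piece i)"
proof (intro equalityI subsetI)
  fix z assume "z \<in> data E {#(0, \<infinity>), (1, 4)#}"
  then obtain a b p where *: "z $ a = 0" "z $ b = 1" "p \<in> path a b" "z $ p = 4" "two_wells z a b"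
    unfolding data_iff_wells by blast
  then have z: "z \<in> cell a 0 p b 1" using cell_iff by blast
  have ne: "p \<noteq> a" "p \<noteq> b" using * by auto
  show "z \<in> (\<Union>j<n. U_piece j) \<union> (\<Union>i<n. W_piece i)"
  proof (cases "p = c")
    case True
    then have ab: "a \<noteq> c" "b \<noteq> c" "br a \<noteq> br b" using ne *(3) by (auto simp: c_in_path_iff)
    then have "z \<in> saddle (br a) 0 (br b) 1" using z True by (auto simp: saddle_def cells_def branch_def)
    then have "z \<in> U_piece (br b)" using ab br_less[of a] by (auto simp: U_piece_def)
    then show ?thesis using br_less[OF ab(2)] by blast
  next
    case False
    then have pb: "p \<in> branch (br p)" "br p < n" using br_less by (auto simp: branch_def)
    have "anc p a \<noteq> anc p b" using *(3) ne False by (simp add: in_path_iff)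
    then consider "a \<in> outer p" "b \<in> inner p" | "b \<in> outer p" "a \<in> inner p"
      using ne by (auto simp: outer_def inner_def)
    then show ?thesis
    proof cases
      case 1
      then have "z \<in> W_piece (br p)" using towerI[OF pb(1)] z by (auto simp: W_piece_def)
      then show ?thesis using pb by blast
    next
      case 2
      then have "z \<in> U_piece (br p)" using towerI[OF pb(1)] z cell_commute[of a 0 p b 1] by (auto simp: U_piece_def)
      then show ?thesis using pb by blast
    qed
  qed
next
  fix z assume "z \<in> (\<Union>j<n. U_piece j) \<union> (\<Union>i<n. W_piece i)"
  then obtain a p b where "z \<in> cell a 0 p b 1" "p \<in> path a b"
    using W_pieceE U_pieceE' by (metis UN_E Un_iff lessThan_iff)
  then show "z \<in> data E {#(0, \<infinity>), (1, 4)#}" unfolding data_iff_wells using cell_iff by blast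
qed

lemma bipartite_pieces: "bipartite_AR_cover n U_piece W_piece"
proof -
  have W: "closed (W_piece i)" "AR (W_piece i)" if "i < n" for i
    using that by (auto simp: W_piece_def closed_tower AR_tower)
  have WW: "i = i'" if z: "z \<in> W_piece i" "z \<in> W_piece i'" "i < n" "i' < n" for z i i'
  proof -
    obtain a p b where p: "p \<in> branch i" "a \<in> outer p" "b \<in> inner p" "z \<in> cell a 0 p b 1" "p \<in> path a b"
      using W_pieceE z(1,3) by blast
    obtain a' p' b' where p': "p' \<in> branch i'" "a' \<in> outer p'" "b' \<in> inner p'" "z \<in> cell a' 0 p' b' 1" "p' \<in> path a' b'"
      using W_pieceE z(2,4) by blast
    have "p \<notin> path a a'" by (rule cells_same_sides(1)[OF p(4) p'(4) p(5) p'(5)])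
    then have "anc p a'" using p by (auto simp: in_path_iff outer_def branch_def)
    then show ?thesis using p p' by (auto simp: outer_iff branch_def anc_def)
  qed
  have UU: "j = j'" if z: "z \<in> U_piece j" "z \<in> U_piece j'" "j < n" "j' < n" for z j j'
  proof -
    obtain a p b where p: "b \<in> branch j" "z \<in> cell a 0 p b 1" "p \<in> path a b"
       "p \<in> branch j \<and> b \<in> outer p \<and> a \<in> inner p \<or> p = c \<and> a \<noteq> c \<and> br a \<noteq> j" using U_pieceE' z(1,3) by blast
    obtain a' p' b' where p': "b' \<in> branch j'" "z \<in> cell a' 0 p' b' 1" "p' \<in> path a' b'"
      using U_pieceE' z(2,4) by metis
    have np: "p \<notin> path b b'" by (rule cells_same_sides(3)[OF p(2) p'(2) p(3) p'(3)])
    show ?thesis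
    proof (cases "p = c")
      case True
      then show ?thesis using np p(1) p'(1) by (auto simp: c_in_path_iff branch_def)
    next
      case False
      then have "anc p b'" using np p by (auto simp: in_path_iff outer_def)
      then show ?thesis using p p'(1) False by (auto simp: branch_def anc_def)
    qed
  qed
  \<comment> \<open>A common vector has value 4 at \<open>c\<close> as well, so its peak can be
    moved to the centre.\<close>
  have UW_sub: "i \<noteq> j \<and> z \<in> saddle i 0 j 1" if z: "z \<in> U_piece j" "z \<in> W_piece i" "i < n" "j < n" for z i j
  proof -
    obtain a p b where p: "b \<in> branch j" "z \<in> cell a 0 p b 1" "p \<in> path a b"
       "p \<in> branch j \<and> b \<in> outer p \<and> a \<in> inner p \<or> p = c \<and> a \<noteq> c \<and> br a \<noteq> j" using U_pieceE' z(1,4) by blast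
    obtain a' p' b' where p': "p' \<in> branch i" "a' \<in> outer p'" "b' \<in> inner p'" "z \<in> cell a' 0 p' b' 1" "p' \<in> path a' b'"
      using W_pieceE z(2,3) by blast
    note sides = cells_same_sides[OF p(2) p'(4) p(3) p'(5)]
    have p'c: "p' \<noteq> c" using p' by (auto simp: branch_def)
    have "anc p' a" using sides(2) p'(2) p'c by (auto simp: in_path_iff outer_def)
    then have a: "a \<in> branch i" using p'(1) p'c by (auto simp: branch_def anc_def)
    show ?thesis
    proof (cases "p = c")
      case True
      then have "i \<noteq> j" using p(4) a by (auto simp: branch_def)
      then show ?thesis using True a p(1,2) by (auto simp: saddle_def cells_def)
    next
      case False
      then have pj: "p \<in> branch j" "b \<in> outer p" "a \<in> inner p" using p(4) by auto
      have b': "anc p b'" using sides(3) pj(2) False by (auto simp: in_path_iff outer_def)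
      have a': "\<not> anc p a'" using sides(1) pj(3) False by (auto simp: in_path_iff inner_def)
      \<comment> \<open>On a common branch one peak is an ancestor of the other, and the wells of
        the two triples would lie on different sides.\<close>
      have "i \<noteq> j"
      proof
        assume "i = j"
        then have "anc p p' \<or> anc p' p" using pj(1) p'(1) anc_in_branch by (metis nat_le_linear)
        then show False using anc_trans a' b' p'(2,3) by (auto simp: outer_def inner_def)
      qed
      then have cab: "c \<in> path a b" using a p(1) c_in_path_branches by blast
      \<comment> \<open>\<open>p'\<close> separates \<open>c\<close> from the deep well
        \<open>a'\<close>, so \<open>c\<close> is low towards \<open>b'\<close>; that path crosses
        \<open>p\<close>.\<close>
      have "p' \<in> path c a'" using p'(2) p'c not_anc_c by (auto simp: in_path_iff outer_def)
      moreover have "p \<in> path c b'" using b' False not_anc_c by (auto simp: in_path_iff)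
      ultimately have "4 \<le> z $ c" using cellD(5)[OF p'(4)] cellD(3)[OF p(2)] by metis
      moreover have "z $ c \<le> 4" using cell_iff[OF p(3)] p(2) cab unfolding two_wells_def by blast
      ultimately have "z \<in> cell a 0 c b 1" using cell_iff[OF p(3)] cell_iff[OF cab] p(2) by auto
      then show ?thesis using \<open>i \<noteq> j\<close> a p(1) by (auto simp: saddle_def cells_def)
    qed
  qed
  have UW: "AR (U_piece j \<inter> W_piece i)" if "i < n" "j < n" "i \<noteq> j" for i j
  proof -
    have "saddle i 0 j 1 \<subseteq> U_piece j" using that by (auto simp: U_piece_def)
    then have "U_piece j \<inter> W_piece i = tower i 0 1 \<inter> saddle i 0 j 1"
      using UW_sub[OF _ _ that(1,2)] unfolding W_piece_def by blast
    then show ?thesis using AR_tower_Int_saddle that by simp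
  qed
  have U: "closed (U_piece j)" "AR (U_piece j)" if "j < n" for j
  proof -
    show "closed (U_piece j)" unfolding U_piece_def
      by (intro closed_Un closed_tower closed_UN ballI closed_saddle) auto
    show "AR (U_piece j)" unfolding U_piece_def
    proof (rule AR_Un_family)
      show "AR (tower j 1 0 \<inter> saddle i 0 j 1)" if "i \<in> {..<n}-{j}" for i
        using AR_tower_Int_saddle[of j i 1 0] that \<open>j < n\<close> saddle_commute[of j 1 i 0] by auto
      show "saddle i 0 j 1 \<inter> saddle k 0 j 1 \<subseteq> tower j 1 0"
        if ik: "i \<in> {..<n}-{j}" "k \<in> {..<n}-{j}" "i \<noteq> k" for i k
      proof -
        \<comment> \<open>With deep wells on different branches, the peak \<open>c\<close> would lie
          between them.\<close>
        have False if z: "z \<in> saddle i 0 j 1" "z \<in> saddle k 0 j 1" for z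
        proof -
          obtain a b where 1: "a \<in> branch i" "b \<in> branch j" "z \<in> cell a 0 c b 1"
            using z(1) by (auto simp: saddle_def cells_def)
          obtain a' b' where 2: "a' \<in> branch k" "b' \<in> branch j" "z \<in> cell a' 0 c b' 1"
            using z(2) by (auto simp: saddle_def cells_def)
          have "c \<in> path a b" "c \<in> path a' b'" "c \<in> path a a'"
            using 1 2 ik c_in_path_branches by blast+
          then show False using cells_same_sides(1)[OF 1(3) 2(3)] by blast
        qed
        then show ?thesis by blast
      qed
    qed (use that in \<open>auto simp: closed_tower closed_saddle AR_tower AR_saddle\<close>)
  qed
  have "U_piece i \<inter> W_piece i = {}" if "i < n" for i using UW_sub[OF _ _ that that] by blast
  moreover have "U_piece i \<inter> U_piece j = {}" "W_piece i \<inter> W_piece j = {}" if "i < n" "j < n" "i \<noteq> j" for i j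
    using UU[OF _ _ that(1,2)] WW[OF _ _ that(1,2)] that(3) by blast+
  ultimately show ?thesis unfolding bipartite_AR_cover_def using U W UW by simp
qed

lemma data_homotopy_eqv_bouquet:
  assumes "3 \<le> n"
  shows "data E {#(0, \<infinity>), (1, 4)#} homotopy_eqv bouquet (n^2 - 3*n + 1)"
  unfolding data_eq_pieces by (rule bipartite_AR_cover_homotopy_eqv_bouquet[OF assms bipartite_pieces])

end

theorem theorem8p1:
  fixes E :: "('v::finite) set set" and n :: nat
  assumes "n \<ge> 3" and "star_like_tree E n"
  shows "data E {#(0, \<infinity>), (1, 4)#} homotopy_eqv bouquet (n^2 - 3*n + 1)"
proof -
  obtain br dp c where "star_tree E n br dp c"
    using star_like_tree_imp_star_tree[OF assms(2)] .
  then show ?thesis using star_tree.data_homotopy_eqv_bouquet assms(1) by blast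
qed

end
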